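(* Let $\pi$ be a non-trivial hereditary graph property and let $k$ be the number of vertices of a smallest forbidden subgraph of $\pi$ (a smallest graph not having $\pi$). If there is a $c$-competitive online algorithm with advice for $\textsc{Max-}\pi$ with preemption that reads $b(nk)$ bits of advice on inputs of length $nk$, then there exists a $c$-competitive online algorithm with advice for anti-$k$-SGKH which, on inputs of length $n$, reads $b(kn)+O(\log^2 n)$ bits of advice.
   Context: A graph property is a collection of graphs; it is non-trivial if infinitely many graphs have it and infinitely many do not; it is hereditary if every induced subgraph of a graph with the property also has it. Online vertex-arrival model: an input is a graph $G$ with vertices $v_1,\dots,v_N$ presented one at a time; when $v_i$ is presented, all edges $\{v_j,v_i\}$ with $j<i$ are revealed; neither $G$ nor $N$ is known in advance. $\textsc{Max-}\pi$ with preemption: when a vertex arrives, the algorithm may accept or reject it, and may additionally preempt (discard) any previously accepted vertices; rejected or preempted vertices can never be accepted later. After each request, the current set $S$ of accepted, non-preempted vertices must induce a subgraph $G[S]$ with property $\pi$; the profit is the size of the final set $S$. Anti-$k$-SGKH (anti-string guessing with known history over an alphabet of size $k$): the input is $x_0,x_1,\dots,x_n$ with $x_0=n$ and $x_i\in\{1,\dots,k\}$ for $i\ge1$; the algorithm outputs $y_1,\dots,y_n\in\{1,\dots,k\}$ where $y_i$ may depend on the advice and on $x_0,\dots,x_{i-1}$; the profit is the number of positions $i$ with $y_i\neq x_i$ (to be maximized). Advice model: the algorithm has access to an infinite binary advice string $\phi$ (chosen with knowledge of the whole input), and its decisions at step $i$ may depend on $\phi$ and the requests seen so far. An algorithm for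 a maximization problem is $c$-competitive with advice complexity $b(n)$ if for every $n$ and every input $I$ of length at most $n$ there exists $\phi$ such that its profit on $I$ with advice $\phi$ is at least $\frac{1}{c}$ times the optimal profit on $I$, and at most the first $b(n)$ bits of $\phi$ are read. *)

theory Defs
  imports
    Complex_Main
    "HOL-Library.Landau_Symbols"
    "Graph_Theory.Pair_Digraph"
    "Graph_Theory.Digraph_Component"
    "Graph_Theory.Digraph_Isomorphism"
begin

section \<open>Graph properties\<close>

text \<open>
  Finite simple undirected graphs are the finite, loop-free digraphs with a symmetric arc
  relation, i.e. the locale \<open>pair_graph\<close>. The graph without vertices is included. As every finite
  graph is isomorphic to one on natural numbers, a graph property is an isomorphism-closed
  collection of graphs with vertices in \<open>nat\<close>.
\<close>

definition graph_property :: "nat pair_pre_digraph set \<Rightarrow> bool" where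
  "graph_property \<pi> \<longleftrightarrow>
     (\<forall>G\<in>\<pi>. pair_graph G) \<and>
     (\<forall>G H. G \<in> \<pi> \<longrightarrow> pair_graph H \<longrightarrow> digraph_iso (with_proj G) (with_proj H) \<longrightarrow> H \<in> \<pi>)"

definition graph_iso_rel :: "nat pair_pre_digraph rel" where
  "graph_iso_rel =
     {(G, H). pair_graph G \<and> pair_graph H \<and> digraph_iso (with_proj G) (with_proj H)}"

text \<open>
  ``Infinitely many graphs'' is meant up to isomorphism: with labelled graphs, already the
  one-vertex graphs would be infinitely many.
\<close>

definition nontrivial_property :: "nat pair_pre_digraph set \<Rightarrow> bool" where
  "nontrivial_property \<pi> \<longleftrightarrow>
     infinite ({G. pair_graph G \<and> G \<in> \<pi>} // graph_iso_rel) \<and>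
     infinite ({G. pair_graph G \<and> G \<notin> \<pi>} // graph_iso_rel)"

definition hereditary :: "nat pair_pre_digraph set \<Rightarrow> bool" where
  "hereditary \<pi> \<longleftrightarrow>
     (\<forall>G\<in>\<pi>. \<forall>H. induced_subgraph (with_proj H) (with_proj G) \<longrightarrow> H \<in> \<pi>)"

definition smallest_forbidden :: "nat pair_pre_digraph set \<Rightarrow> nat pair_pre_digraph \<Rightarrow> bool" where
  "smallest_forbidden \<pi> H \<longleftrightarrow>
     pair_graph H \<and> H \<notin> \<pi> \<and>
     (\<forall>G. pair_graph G \<longrightarrow> G \<notin> \<pi> \<longrightarrow> card (pverts H) \<le> card (pverts G))"

definition pair_induce :: "'a pair_pre_digraph \<Rightarrow> 'a set \<Rightarrow> 'a pair_pre_digraph" where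
  "pair_induce G S = \<lparr> pverts = S, parcs = parcs G \<inter> S \<times> S \<rparr>"

lemma with_proj_pair_induce: "with_proj (pair_induce G S) = with_proj G \<restriction> S"
  by (auto simp: pair_induce_def with_proj_def induce_subgraph_def)


section \<open>Online maximization problems and advice\<close>

text \<open>
  An input is the list of its requests; an output consists of \<open>input_length\<close> many answers, and the
  \<open>i\<close>-th answer (counting from 1) is due when exactly the first \<open>i\<close> requests are known.
\<close>

record ('r, 'a) online_problem =
  inputs :: "'r list set"
  input_length :: "'r list \<Rightarrow> nat"
  feasible :: "'r list \<Rightarrow> 'a list \<Rightarrow> bool"
  profit :: "'r list \<Rightarrow> 'a list \<Rightarrow> nat"

type_synonym advice = "nat \<Rightarrow> bool"

type_synonym ('r, 'a) online_alg = "advice \<Rightarrow> 'r list \<Rightarrow> 'a"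

definition run ::
  "('r, 'a) online_problem \<Rightarrow> ('r, 'a) online_alg \<Rightarrow> advice \<Rightarrow> 'r list \<Rightarrow> 'a list" where
  "run P A \<phi> I = map (\<lambda>i. A \<phi> (take i I)) [1..<Suc (input_length P I)]"

definition opt :: "('r, 'a) online_problem \<Rightarrow> 'r list \<Rightarrow> nat" where
  "opt P I = Max {profit P I ys | ys. length ys = input_length P I \<and> feasible P I ys}"

definition online_algorithm :: "('r, 'a) online_problem \<Rightarrow> ('r, 'a) online_alg \<Rightarrow> bool" where
  "online_algorithm P A \<longleftrightarrow> (\<forall>\<phi>. \<forall>I\<in>inputs P. feasible P I (run P A \<phi> I))"

text \<open>
  On input \<open>I\<close> with advice \<open>\<phi>\<close> only the first \<open>m\<close> advice bits are read: no answer depends on the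
  remaining ones.
\<close>

definition reads_at_most ::
  "('r, 'a) online_problem \<Rightarrow> ('r, 'a) online_alg \<Rightarrow> advice \<Rightarrow> 'r list \<Rightarrow> nat \<Rightarrow> bool" where
  "reads_at_most P A \<phi> I m \<longleftrightarrow>
     (\<forall>\<psi>. (\<forall>j<m. \<psi> j = \<phi> j) \<longrightarrow> run P A \<psi> I = run P A \<phi> I)"

definition competitive_with_advice ::
  "('r, 'a) online_problem \<Rightarrow> ('r, 'a) online_alg \<Rightarrow> real \<Rightarrow> (nat \<Rightarrow> nat) \<Rightarrow> bool" where
  "competitive_with_advice P A c b \<longleftrightarrow>
     online_algorithm P A \<and>
     (\<forall>n. \<forall>I\<in>inputs P. input_length P I \<le> n \<longrightarrow>
        (\<exists>\<phi>. real (profit P I (run P A \<phi> I)) \<ge> 1 / c * real (opt P I) \<and>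
             reads_at_most P A \<phi> I (b n)))"


section \<open>Max-\<open>\<pi>\<close> with preemption\<close>

text \<open>
  Vertices are numbered 0, 1, 2, ... in order of arrival, and the request for vertex \<open>i\<close> is the
  set of its neighbours among \<open>{..<i}\<close>.
\<close>

definition input_graph :: "nat set list \<Rightarrow> nat pair_pre_digraph" where
  "input_graph I =
     \<lparr> pverts = {..<length I},
       parcs = {(j, i). i < length I \<and> j \<in> I ! i} \<union> {(i, j). i < length I \<and> j \<in> I ! i} \<rparr>"

text \<open>
  An answer \<open>(a, D)\<close> accepts the arriving vertex iff \<open>a\<close> holds and preempts the vertices in \<open>D\<close>;
  \<open>kept ys t\<close> is the set of accepted, non-preempted vertices after the first \<open>t\<close> requests.
\<close>

primrec kept :: "(bool \<times> nat set) list \<Rightarrow> nat \<Rightarrow> nat set" where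
  "kept ys 0 = {}"
| "kept ys (Suc t) = (kept ys t - snd (ys ! t)) \<union> (if fst (ys ! t) then {t} else {})"

definition max_preempt ::
  "nat pair_pre_digraph set \<Rightarrow> (nat set, bool \<times> nat set) online_problem" where
  "max_preempt \<pi> =
     \<lparr> inputs = {I. \<forall>i<length I. I ! i \<subseteq> {..<i}},
       input_length = length,
       feasible = (\<lambda>I ys. \<forall>t<length I. pair_induce (input_graph I) (kept ys (Suc t)) \<in> \<pi>),
       profit = (\<lambda>I ys. card (kept ys (length I))) \<rparr>"


section \<open>Anti-string guessing with known history\<close>

text \<open>
  The requests are \<open>x\<^sub>0 = n, x\<^sub>1, ..., x\<^sub>n\<close>, the answers \<open>y\<^sub>1, ..., y\<^sub>n\<close>; so \<open>x\<^sub>i\<close> is \<open>I ! i\<close> and \<open>y\<^sub>i\<close> is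
  \<open>ys ! (i - 1)\<close>. The length of the input is \<open>n\<close>, not the number \<open>n + 1\<close> of requests.
\<close>

definition anti_sgkh :: "nat \<Rightarrow> (nat, nat) online_problem" where
  "anti_sgkh k =
     \<lparr> inputs = {n # xs | n xs. length xs = n \<and> set xs \<subseteq> {1..k}},
       input_length = (\<lambda>I. length I - 1),
       feasible = (\<lambda>I ys. set ys \<subseteq> {1..k}),
       profit = (\<lambda>I ys. card {i \<in> {1..length I - 1}. ys ! (i - 1) \<noteq> I ! i}) \<rparr>"

end

theory Submission
  imports Defs "HOL-Library.Log_Nat" "HOL-Library.Disjoint_Sets"
begin

text \<open>
  An instance of anti-guessing with \<open>n\<close> unknown symbols becomes a graph on \<open>n\<close> blocks of \<open>k\<close>
  vertices, each inducing the forbidden graph \<open>H\<close>, so that after each block the algorithm for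
  Max-\<open>\<pi>\<close> has dropped one of its vertices; the guess is the position of that vertex. When \<open>x\<^sub>i\<close> is
  revealed, vertex \<open>x\<^sub>i\<close> of block \<open>i\<close> becomes good and the others bad. Good vertices are joined to
  later blocks as in a graph on \<open>n\<close> vertices with property \<open>\<pi>\<close>, so keeping all of them yields
  profit \<open>n\<close>. Bad vertices are joined to later blocks as in a random-like relation in which every
  set of \<open>s = O(log n)\<close> blocks contains an induced copy of \<open>H\<close>, so at most \<open>k s\<close> bad vertices
  survive, while every surviving good vertex comes from a correct guess. Additional advice names up
  to \<open>k s\<close> wrong guesses, in \<open>O(log n)\<close> bits each, which makes up for the bad vertices.
\<close>

section \<open>Hereditary graph properties\<close>

lemma pair_graph_iff:
  "pair_graph G \<longleftrightarrow> finite (pverts G) \<and> parcs G \<subseteq> pverts G \<times> pverts G \<and> sym (parcs G) \<and> irrefl (parcs G)"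
proof
  assume "pair_graph G"
  then interpret pair_graph G .
  show "finite (pverts G) \<and> parcs G \<subseteq> pverts G \<times> pverts G \<and> sym (parcs G) \<and> irrefl (parcs G)"
    using pair_finite_verts in_arcsD1 in_arcsD2 pair_sym_arcs no_loops'
    by (intro conjI) (auto simp: symmetric_def irrefl_def, blast)
next
  assume *: "finite (pverts G) \<and> parcs G \<subseteq> pverts G \<times> pverts G \<and> sym (parcs G) \<and> irrefl (parcs G)"
  then have "finite (parcs G)"
    using finite_subset by blast
  with * show "pair_graph G"
    by unfold_locales (auto simp: symmetric_def irrefl_def)
qed

lemma graph_propertyD:
  assumes "graph_property \<pi>" "G \<in> \<pi>"
  shows "pair_graph G"
    and "pair_graph H \<Longrightarrow> digraph_iso (with_proj G) (with_proj H) \<Longrightarrow> H \<in> \<pi>"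
  using assms unfolding graph_property_def by blast+

section \<open>Isomorphisms and induced copies\<close>

lemma digraph_iso_with_projI:
  assumes "pair_graph G" "pair_graph H" "bij_betw f (pverts G) (pverts H)"
    and "\<And>u v. u \<in> pverts G \<Longrightarrow> v \<in> pverts G \<Longrightarrow> (f u, f v) \<in> parcs H \<longleftrightarrow> (u, v) \<in> parcs G"
  shows "digraph_iso (with_proj G) (with_proj H)"
proof -
  interpret G: pair_graph G by fact
  interpret H: pair_graph H by fact
  define h where "h = \<lparr>iso_verts = f, iso_arcs = map_prod f f, iso_head = snd, iso_tail = fst\<rparr>"
  have inj: "inj_on f (pverts G)" and im: "f ` pverts G = pverts H"
    using assms(3) by (auto simp: bij_betw_def)
  have "inj_on (map_prod f f) (parcs G)"
    by (rule inj_on_subset[OF map_prod_inj_on[OF inj inj]]) (use G.in_arcsD1 G.in_arcsD2 in auto)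
  then have "pre_digraph.digraph_isomorphism (with_proj G) h"
    using inj by (auto simp: pre_digraph.digraph_isomorphism_def h_def G.wf_digraph_axioms)
  moreover have "parcs H = map_prod f f ` parcs G"
  proof (intro equalityI subsetI)
    fix e assume "e \<in> parcs H"
    then obtain a b where e: "e = (a, b)" "(a, b) \<in> parcs H" "a \<in> f ` pverts G" "b \<in> f ` pverts G"
      using H.in_arcsD1 H.in_arcsD2 im by (cases e) auto
    then show "e \<in> map_prod f f ` parcs G"
      using assms(4) by force
  next
    fix e assume "e \<in> map_prod f f ` parcs G"
    then show "e \<in> parcs H"
      using G.in_arcsD1 G.in_arcsD2 assms(4) by force
  qed
  then have "with_proj H = app_iso h (with_proj G)"
    by (simp add: with_proj_def app_iso_def h_def im)
  ultimately show ?thesis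
    unfolding digraph_iso_def by blast
qed

lemma digraph_iso_with_proj_sym:
  assumes "pair_graph G" "digraph_iso (with_proj G) (with_proj H)"
  shows "digraph_iso (with_proj H) (with_proj G)"
proof -
  interpret pair_graph G by fact
  show ?thesis
    using digraph_iso_swap[OF wf_digraph_axioms assms(2)] .
qed

lemma pair_graph_pair_induce:
  "pair_graph G \<Longrightarrow> S \<subseteq> pverts G \<Longrightarrow> pair_graph (pair_induce G S)"
  unfolding pair_graph_iff pair_induce_def
  by (auto intro: finite_subset symI irreflI dest: symD irreflD)

lemma hereditary_pair_induce:
  assumes "graph_property \<pi>" "hereditary \<pi>" "G \<in> \<pi>" "S \<subseteq> pverts G"
  shows "pair_induce G S \<in> \<pi>"
proof -
  have G: "pair_graph G"
    using graph_propertyD(1)[OF assms(1,3)] .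
  then interpret G: pair_graph G .
  interpret S: pair_graph "pair_induce G S"
    using pair_graph_pair_induce[OF G assms(4)] .
  have "induced_subgraph (with_proj (pair_induce G S)) (with_proj G)"
    using assms(4) G.wf_digraph_axioms S.wf_digraph_axioms
    by (auto simp: induced_subgraph_def subgraph_def pair_induce_def)
  with assms(2,3) show ?thesis
    by (auto simp: hereditary_def)
qed

text \<open>The image of \<open>f\<close> induces a subgraph of \<open>G\<close> isomorphic to
  \<open>H\<close>. Used forwards to certify that a vertex set is feasible, and by contraposition to
  exclude copies of a forbidden graph.\<close>

lemma hereditary_embed:
  assumes "graph_property \<pi>" "hereditary \<pi>" "G \<in> \<pi>" "pair_graph H"
    and inj: "inj_on f (pverts H)" and sub: "f ` pverts H \<subseteq> pverts G"
    and arcs: "\<And>u v. u \<in> pverts H \<Longrightarrow> v \<in> pverts H \<Longrightarrow> (f u, f v) \<in> parcs G \<longleftrightarrow> (u, v) \<in> parcs H"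
  shows "H \<in> \<pi>"
proof -
  let ?S = "f ` pverts H"
  have mem: "pair_induce G ?S \<in> \<pi>"
    using hereditary_pair_induce assms(1-3) sub by blast
  have gS: "pair_graph (pair_induce G ?S)"
    using graph_propertyD(1)[OF assms(1) mem] .
  have "digraph_iso (with_proj H) (with_proj (pair_induce G ?S))"
    by (rule digraph_iso_with_projI[OF assms(4) gS, of f])
       (use inj arcs in \<open>auto simp: pair_induce_def bij_betw_def\<close>)
  then have "digraph_iso (with_proj (pair_induce G ?S)) (with_proj H)"
    by (rule digraph_iso_with_proj_sym[OF assms(4)])
  with graph_propertyD(2)[OF assms(1) mem assms(4)] show ?thesis .
qed

text \<open>Normal form of a graph: it makes isomorphism classes countable by size and lets the
  vertices of the forbidden graph serve as positions in a block.\<close>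

lemma ex_iso_on_lessThan:
  assumes "pair_graph G"
  obtains G' where "pair_graph G'" "pverts G' = {..<card (pverts G)}"
    "digraph_iso (with_proj G) (with_proj G')"
proof -
  have G: "finite (pverts G)" "parcs G \<subseteq> pverts G \<times> pverts G" "sym (parcs G)" "irrefl (parcs G)"
    using assms by (auto simp: pair_graph_iff)
  obtain f where f: "bij_betw f (pverts G) {..<card (pverts G)}"
    using G(1) ex_bij_betw_finite_nat by (metis atLeast0LessThan)
  then have inj: "inj_on f (pverts G)"
    by (simp add: bij_betw_def)
  define G' where "G' = \<lparr>pverts = {..<card (pverts G)}, parcs = map_prod f f ` parcs G\<rparr>"
  have pverts_G': "pverts G' = {..<card (pverts G)}" and parcs_G': "parcs G' = map_prod f f ` parcs G"
    by (simp_all add: G'_def)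
  have arcs: "(f u, f v) \<in> parcs G' \<longleftrightarrow> (u, v) \<in> parcs G" if "u \<in> pverts G" "v \<in> pverts G" for u v
  proof
    assume "(f u, f v) \<in> parcs G'"
    then obtain a b where ab: "(a, b) \<in> parcs G" "f u = f a" "f v = f b"
      by (auto simp: parcs_G')
    moreover from ab(1) G(2) have "a \<in> pverts G" "b \<in> pverts G"
      by auto
    ultimately have "u = a" "v = b"
      using that inj by (meson inj_onD)+
    with ab show "(u, v) \<in> parcs G"
      by simp
  next
    assume "(u, v) \<in> parcs G"
    then show "(f u, f v) \<in> parcs G'"
      unfolding parcs_G' by (rule map_prod_imageI)
  qed
  have "parcs G' \<subseteq> pverts G' \<times> pverts G'"
  proof -
    have "map_prod f f ` parcs G \<subseteq> map_prod f f ` (pverts G \<times> pverts G)"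
      using G(2) by (rule image_mono)
    then show ?thesis
      using f by (simp add: pverts_G' parcs_G' bij_betw_def map_prod_surj_on)
  qed
  moreover have "sym (parcs G')"
    unfolding sym_def
  proof (intro allI impI)
    fix x y assume "(x, y) \<in> parcs G'"
    then obtain a b where "(a, b) \<in> parcs G" "x = f a" "y = f b"
      by (auto simp: parcs_G')
    then have "x = f a" "y = f b" "(b, a) \<in> parcs G"
      using G(3) by (auto dest: symD)
    then show "(y, x) \<in> parcs G'"
      unfolding parcs_G' by (simp only: map_prod_imageI)
  qed
  moreover have "irrefl (parcs G')"
    unfolding irrefl_def
  proof (intro allI notI)
    fix x assume "(x, x) \<in> parcs G'"
    then obtain a b where "(a, b) \<in> parcs G" "f a = f b"
      by (auto simp: parcs_G')
    moreover from this G(2) have "a \<in> pverts G" "b \<in> pverts G"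
      by auto
    ultimately have "a = b" "(a, b) \<in> parcs G"
      using inj by (auto dest: inj_onD)
    then show False
      using G(4) by (simp add: irrefl_def)
  qed
  ultimately have "pair_graph G'"
    by (auto simp: pair_graph_iff pverts_G')
  moreover from this have "digraph_iso (with_proj G) (with_proj G')"
    by (rule digraph_iso_with_projI[OF assms]) (use f arcs in \<open>simp_all add: pverts_G'\<close>)
  ultimately show ?thesis
    using that pverts_G' by blast
qed

section \<open>Members of every size, and the size of a smallest forbidden graph\<close>

lemma equiv_graph_iso_rel: "equiv {G. pair_graph G} graph_iso_rel"
proof (rule equivI)
  show "graph_iso_rel \<subseteq> {G. pair_graph G} \<times> {G. pair_graph G}"
    by (auto simp: graph_iso_rel_def)
  show "refl_on {G. pair_graph G} graph_iso_rel"
    using digraph_iso_with_projI[where f = id] by (auto simp: refl_on_def graph_iso_rel_def)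
  show "sym graph_iso_rel"
    using digraph_iso_with_proj_sym by (auto simp: sym_def graph_iso_rel_def)
  show "trans graph_iso_rel"
    unfolding trans_def graph_iso_rel_def using digraph_iso_trans by blast
qed

text \<open>Graphs with fewer than \<open>n\<close> vertices have representatives inside
  \<open>{..<n}\<close>, so they fall into only finitely many classes.\<close>

lemma infinite_classes_imp_large:
  assumes "infinite ({G. pair_graph G \<and> G \<in> \<pi>} // graph_iso_rel)"
  obtains G where "pair_graph G" "G \<in> \<pi>" "n \<le> card (pverts G)"
proof (rule ccontr)
  assume "\<not> thesis"
  with that have small: "card (pverts G) < n" if "pair_graph G" "G \<in> \<pi>" for G
    using that by (meson not_le)
  \<comment> \<open>All pairs of a vertex set and an arc set, whether or not they form a graph: only
    finiteness matters.\<close>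
  define F where "F = (\<lambda>(V, E). \<lparr>pverts = V, parcs = E\<rparr>) ` (Pow {..<n} \<times> Pow ({..<n} \<times> {..<n :: nat}))"
  have "{G. pair_graph G \<and> G \<in> \<pi>} // graph_iso_rel \<subseteq> (\<lambda>G. graph_iso_rel `` {G}) ` F"
  proof
    fix X assume "X \<in> {G. pair_graph G \<and> G \<in> \<pi>} // graph_iso_rel"
    then obtain G where G: "pair_graph G" "G \<in> \<pi>" "X = graph_iso_rel `` {G}"
      by (auto simp: quotient_def)
    from ex_iso_on_lessThan[OF G(1)] obtain G' where G': "pair_graph G'"
      "pverts G' = {..<card (pverts G)}" "digraph_iso (with_proj G) (with_proj G')" .
    have "(G, G') \<in> graph_iso_rel"
      using G G' by (auto simp: graph_iso_rel_def)
    then have "X = graph_iso_rel `` {G'}"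
      using equiv_class_eq[OF equiv_graph_iso_rel] G(3) by blast
    moreover have "G' \<in> F"
      unfolding F_def
    proof (rule image_eqI)
      show "G' = (case (pverts G', parcs G') of (V, E) \<Rightarrow> \<lparr>pverts = V, parcs = E\<rparr>)"
        by simp
      have "pverts G' \<subseteq> {..<n}"
        using G'(2) small[OF G(1,2)] by auto
      moreover have "parcs G' \<subseteq> pverts G' \<times> pverts G'"
        using G'(1) by (simp add: pair_graph_iff)
      ultimately show "(pverts G', parcs G') \<in> Pow {..<n} \<times> Pow ({..<n} \<times> {..<n})"
        by blast
    qed
    ultimately show "X \<in> (\<lambda>G. graph_iso_rel `` {G}) ` F"
      by blast
  qed
  moreover have "finite F"
    by (simp add: F_def)
  ultimately show False
    using assms finite_subset by blast
qed

text \<open>A sufficiently large member is cut down to its first \<open>n\<close> vertices. This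
  supplies the graph along which good vertices are joined.\<close>

lemma ex_member_on_lessThan:
  assumes "graph_property \<pi>" "nontrivial_property \<pi>" "hereditary \<pi>"
  obtains G where "G \<in> \<pi>" "pverts G = {..<n}"
proof -
  obtain G where G: "pair_graph G" "G \<in> \<pi>" "n \<le> card (pverts G)"
    using infinite_classes_imp_large assms(2) unfolding nontrivial_property_def by metis
  from ex_iso_on_lessThan[OF G(1)] obtain G' where G': "pair_graph G'"
    "pverts G' = {..<card (pverts G)}" "digraph_iso (with_proj G) (with_proj G')" .
  then have "G' \<in> \<pi>"
    using graph_propertyD(2)[OF assms(1) G(2)] by blast
  then have "pair_induce G' {..<n} \<in> \<pi>"
    by (rule hereditary_pair_induce[OF assms(1,3)]) (use G(3) G'(2) in auto)
  then show ?thesis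
    using that by (simp add: pair_induce_def)
qed

text \<open>A graph with at most one vertex embeds into a one-vertex member. The bound guarantees a
  second symbol by which a wrong guess can be replaced.\<close>

lemma smallest_forbidden_card_ge_2:
  assumes "graph_property \<pi>" "nontrivial_property \<pi>" "hereditary \<pi>" "smallest_forbidden \<pi> H"
  shows "2 \<le> card (pverts H)"
proof (rule ccontr)
  assume "\<not> 2 \<le> card (pverts H)"
  then have c: "card (pverts H) \<le> 1"
    by simp
  have H: "pair_graph H" "H \<notin> \<pi>"
    using assms(4) by (auto simp: smallest_forbidden_def)
  then have eq: "u = v" if "u \<in> pverts H" "v \<in> pverts H" for u v
    using c that by (metis One_nat_def card_le_Suc0_iff_eq pair_graph_iff)
  obtain G where G: "G \<in> \<pi>" "pverts G = {..<1::nat}"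
    using ex_member_on_lessThan assms(1-3) by metis
  have "irrefl (parcs G)"
    using graph_propertyD(1)[OF assms(1) G(1)] by (simp add: pair_graph_iff)
  moreover have "irrefl (parcs H)"
    using H by (auto simp: pair_graph_iff)
  ultimately have arcs: "((0::nat), 0) \<in> parcs G \<longleftrightarrow> (u, v) \<in> parcs H" if "u \<in> pverts H" "v \<in> pverts H" for u v
    using eq[OF that] by (simp add: irrefl_def)
  have "inj_on (\<lambda>_. 0::nat) (pverts H)" "(\<lambda>_. 0) ` pverts H \<subseteq> pverts G"
    using G(2) eq by (auto simp: inj_on_def)
  then have "H \<in> \<pi>"
    using hereditary_embed[OF assms(1,3) G(1) H(1)] arcs by metis
  with H show False
    by simp
qed

section \<open>Relations in which every large set contains a given pattern\<close>

text \<open>Product rule for independent events: a uniformly random \<open>R\<close> within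
  \<open>U\<close> has trace \<open>P i\<close> on \<open>E i\<close> with probability
  \<open>1 / 2 ^ e\<close>, and disjointness of the \<open>E i\<close> makes these events
  independent. The induction splits \<open>R\<close> into its trace on one \<open>E i\<close> and
  the rest.\<close>

lemma card_subsets_avoiding:
  fixes E :: "'i \<Rightarrow> 'b set"
  assumes "finite I" "finite U" "\<And>i. i \<in> I \<Longrightarrow> E i \<subseteq> U" "\<And>i. i \<in> I \<Longrightarrow> card (E i) = e"
    and "\<And>i. i \<in> I \<Longrightarrow> P i \<subseteq> E i" "disjoint_family_on E I"
  shows "real (card {R. R \<subseteq> U \<and> (\<forall>i\<in>I. R \<inter> E i \<noteq> P i)}) = 2 ^ card U * (1 - 1 / 2 ^ e) ^ card I"
  using assms
proof (induction I arbitrary: U rule: finite_induct)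
  case empty
  then show ?case
    using card_Pow[of U] by (simp add: Pow_def)
next
  case (insert i I)
  define A where "A = {X. X \<subseteq> E i \<and> X \<noteq> P i}"
  define B where "B = {R. R \<subseteq> U - E i \<and> (\<forall>j\<in>I. R \<inter> E j \<noteq> P j)}"
  define C where "C = {R. R \<subseteq> U \<and> (\<forall>j\<in>insert i I. R \<inter> E j \<noteq> P j)}"
  have dj: "E i \<inter> E j = {}" if "j \<in> I" for j
    using that insert.prems(5) insert.hyps(2) by (auto simp: disjoint_family_on_def)
  have inter: "(X \<union> R) \<inter> E j = R \<inter> E j" if "X \<subseteq> E i" "j \<in> I" for X R j
    using that dj by blast
  have EU: "E i \<subseteq> U"
    using insert.prems(2) by simp
  then have fE: "finite (E i)" and eU: "e \<le> card U"
    using insert.prems(1,3) finite_subset card_mono[of U "E i"] by auto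
  have "bij_betw (\<lambda>(X, R). X \<union> R) (A \<times> B) C"
  proof (rule bij_betw_byWitness[where f' = "\<lambda>R. (R \<inter> E i, R - E i)"])
    show "\<forall>a\<in>A \<times> B. (\<lambda>R. (R \<inter> E i, R - E i)) ((\<lambda>(X, R). X \<union> R) a) = a"
      by (auto simp: A_def B_def)
    show "\<forall>a'\<in>C. (\<lambda>(X, R). X \<union> R) ((\<lambda>R. (R \<inter> E i, R - E i)) a') = a'"
      by auto
    show "(\<lambda>(X, R). X \<union> R) ` (A \<times> B) \<subseteq> C"
    proof clarsimp
      fix X R assume X: "X \<in> A" and R: "R \<in> B"
      then have "(X \<union> R) \<inter> E i = X"
        by (auto simp: A_def B_def)
      then show "X \<union> R \<in> C"
        using X R EU inter by (auto simp: A_def B_def C_def)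
    qed
    show "(\<lambda>R. (R \<inter> E i, R - E i)) ` C \<subseteq> A \<times> B"
    proof clarsimp
      fix R assume R: "R \<in> C"
      have "(R - E i) \<inter> E j = R \<inter> E j" if "j \<in> I" for j
        using dj[OF that] by blast
      then show "R \<inter> E i \<in> A \<and> R - E i \<in> B"
        using R by (auto simp: A_def B_def C_def)
    qed
  qed
  then have cC: "card C = card A * card B"
    by (metis bij_betw_same_card card_cartesian_product)
  have "A = Pow (E i) - {P i}"
    by (auto simp: A_def)
  then have "card A = 2 ^ e - 1"
    using insert.prems(3,4) fE by (simp add: card_Pow)
  then have cA: "real (card A) = 2 ^ e * (1 - 1 / 2 ^ e)"
    by (simp add: field_simps of_nat_diff)
  have cB: "real (card B) = 2 ^ card (U - E i) * (1 - 1 / 2 ^ e) ^ card I"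
    unfolding B_def
  proof (rule insert.IH)
    show "disjoint_family_on E I"
      using insert.prems(5) by (simp add: disjoint_family_on_def)
    show "E j \<subseteq> U - E i" if "j \<in> I" for j
      using dj[OF that] insert.prems(2) that by blast
  qed (use insert.prems in auto)
  have "card (U - E i) = card U - e"
    using EU fE insert.prems(3) by (simp add: card_Diff_subset)
  then have "(2::real) ^ card U = 2 ^ e * 2 ^ card (U - E i)"
    using eU by (simp flip: power_add)
  then have "real (card C) = 2 ^ card U * (1 - 1 / 2 ^ e) ^ card (insert i I)"
    using insert.hyps by (simp add: cC cA cB)
  then show ?case
    by (simp add: C_def)
qed

lemma one_minus_inverse_power_le_half:
  fixes N :: nat
  assumes "0 < N"
  shows "(1 - 1 / real N) ^ N \<le> 1 / 2"
proof -
  have "(1 - 1 / real N) ^ N \<le> exp (- 1 / real N) ^ N"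
    using exp_ge_add_one_self[of "- 1 / real N"] assms by (intro power_mono) auto
  also have "\<dots> = exp (- 1)"
    using assms by (simp flip: exp_of_nat_mult)
  also have "\<dots> \<le> 1 / 2"
    using exp_ge_add_one_self[of 1] by (simp add: exp_minus field_simps)
  finally show ?thesis .
qed

text \<open>Only pairs \<open>i < j\<close> are compared and \<open>f\<close> is increasing, because
  the reduction consults \<open>R\<close> only from an earlier block to a later one. So
  \<open>R\<close> need not be symmetric.\<close>

definition contains_pattern :: "nat \<Rightarrow> nat rel \<Rightarrow> nat rel \<Rightarrow> nat set \<Rightarrow> bool" where
  "contains_pattern k P R T \<longleftrightarrow>
     (\<exists>f. strict_mono_on {..<k} f \<and> f ` {..<k} \<subseteq> T \<and>
          (\<forall>i j. i < j \<longrightarrow> j < k \<longrightarrow> (f i, f j) \<in> R \<longleftrightarrow> (i, j) \<in> P))"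

text \<open>
  Cut \<open>T\<close> into \<open>k\<close> consecutive parts of size \<open>k q\<close>. The \<open>q\<^sup>2\<close> lines \<open>j \<mapsto> a + b j\<close> with \<open>a, b < q\<close> pick
  one element of every part, and two of them share at most one element. So they are possible places
  for the pattern that use pairwise disjoint sets of pairs.
\<close>

lemma card_avoiding_pattern:
  fixes T :: "nat set" and U :: "nat rel"
  assumes "finite U" "T \<times> T \<subseteq> U" "finite T" "card T = k * k * q" "0 < k"
    and e: "e = card {(i, j). i < j \<and> j < k}"
  shows "real (card {R. R \<subseteq> U \<and> \<not> contains_pattern k P R T}) \<le> 2 ^ card U * (1 - 1 / 2 ^ e) ^ (q * q)"
proof -
  define W where "W = {(i, j). i < j \<and> j < (k::nat)}"
  define t where "t = sorted_list_of_set T"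
  have t: "sorted_wrt (<) t" "length t = k * k * q" "set t = T"
    using assms by (simp_all add: t_def)
  have t_less: "t ! x < t ! y" if "x < y" "y < k * k * q" for x y
    using sorted_wrt_nth_less[OF t(1)] that t(2) by simp
  have t_inj: "x = y" if "t ! x = t ! y" "x < k * k * q" "y < k * k * q" for x y
    using t_less that by (metis less_irrefl linorder_neqE_nat)
  define pos where "pos = (\<lambda>(a, b) j. j * (k * q) + (a + b * j))"
  \<comment> \<open>The offset is at most \<open>(q - 1) + (q - 1) * (k - 1) = (q - 1) * k\<close>,
    so a line stays inside each part and dividing a position by \<open>k * q\<close> recovers the
    part.\<close>
  have off: "a + b * j < k * q" if "a < q" "b < q" "j < k" for a b j
  proof -
    have "b * j \<le> (q - 1) * (k - 1)"
      using that by (intro mult_le_mono) auto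
    moreover have "(q - 1) * (k - 1) + q = (q - 1) * k + 1"
      using that by (cases q; cases k) auto
    moreover have "(q - 1) * k + k = k * q"
      using that by (cases q) auto
    ultimately show ?thesis
      using that by linarith
  qed
  have pos_less: "pos (a, b) j < k * k * q" if "a < q" "b < q" "j < k" for a b j
  proof -
    have "pos (a, b) j < Suc j * (k * q)"
      using off[OF that] by (simp add: pos_def)
    also have "\<dots> \<le> k * (k * q)"
      using that by (intro mult_le_mono1) simp
    finally show ?thesis
      by (simp add: mult.assoc)
  qed
  have pos_mono: "pos (a, b) i < pos (a, b) j" if "i < j" "a < q" "b < q" "i < k" for a b i j
  proof -
    have "pos (a, b) i < Suc i * (k * q)"
      using off[of a b i] that by (simp add: pos_def)
    also have "\<dots> \<le> j * (k * q)"
      using that by (intro mult_le_mono1) simp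
    also have "\<dots> \<le> pos (a, b) j"
      by (simp add: pos_def)
    finally show ?thesis .
  qed
  have div_add: "(x * m + r) div m = x" if "r < m" for x m r :: nat
    using that by simp
  have pos_div: "pos (a, b) j div (k * q) = j" if "a < q" "b < q" "j < k" for a b j
    using div_add[OF off[OF that]] by (simp add: pos_def)
  have pos_eqD: "j = j' \<and> a + b * j = c + d * j'"
    if "pos (a, b) j = pos (c, d) j'" "a < q" "b < q" "j < k" "c < q" "d < q" "j' < k" for a b c d j j'
  proof -
    have "j = j'"
      using pos_div[of a b j] pos_div[of c d j'] that by simp
    with that(1) show ?thesis
      by (simp add: pos_def)
  qed
  define E where "E = (\<lambda>l. (\<lambda>(i, j). (t ! pos l i, t ! pos l j)) ` W)"
  define Q where "Q = (\<lambda>l. (\<lambda>(i, j). (t ! pos l i, t ! pos l j)) ` (W \<inter> P))"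
  define I where "I = {..<q} \<times> {..<q}"
  \<comment> \<open>Two points determine a line. Positions reveal their parts, so
    \<open>i = i'\<close> and \<open>j = j'\<close>; subtracting the two line equations, over
    \<open>int\<close> to avoid truncation, then gives equal slopes.\<close>
  have eq_lines: "(a, b) = (c, d) \<and> i = i' \<and> j = j'"
    if "t ! pos (a, b) i = t ! pos (c, d) i'" "t ! pos (a, b) j = t ! pos (c, d) j'"
      "(i, j) \<in> W" "(i', j') \<in> W" "(a, b) \<in> I" "(c, d) \<in> I" for a b c d i j i' j'
  proof -
    have W: "i < j" "j < k" "i < k" "j' < k" "i' < k" "a < q" "b < q" "c < q" "d < q"
      using that by (auto simp: W_def I_def)
    have "pos (a, b) i = pos (c, d) i'" "pos (a, b) j = pos (c, d) j'"
      using that(1,2) t_inj pos_less W by blast+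
    then have eqs: "i = i'" "a + b * i = c + d * i" "j = j'" "a + b * j = c + d * j"
      using pos_eqD W by blast+
    have "int b * (int j - int i) = int d * (int j - int i)"
      using arg_cong[OF eqs(2), of int] arg_cong[OF eqs(4), of int] by (simp add: algebra_simps)
    then have "b = d"
      using W(1) by simp
    with eqs show ?thesis
      by simp
  qed
  \<comment> \<open>\<open>Q l\<close> is the trace on \<open>E l\<close> that makes the points of
    line \<open>l\<close> carry the pattern. This is only an inclusion, as the pattern may also
    occur off the lines.\<close>
  have "{R. R \<subseteq> U \<and> \<not> contains_pattern k P R T} \<subseteq> {R. R \<subseteq> U \<and> (\<forall>l\<in>I. R \<inter> E l \<noteq> Q l)}"
  proof clarify
    fix R a b assume np: "\<not> contains_pattern k P R T" and l: "(a, b) \<in> I" and eq: "R \<inter> E (a, b) = Q (a, b)"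
    have ab: "a < q" "b < q"
      using l by (auto simp: I_def)
    have "contains_pattern k P R T"
      unfolding contains_pattern_def
    proof (intro exI[of _ "\<lambda>j. t ! pos (a, b) j"] conjI allI impI)
      show "strict_mono_on {..<k} (\<lambda>j. t ! pos (a, b) j)"
        using t_less pos_less pos_mono ab by (auto simp: strict_mono_on_def)
      show "(\<lambda>j. t ! pos (a, b) j) ` {..<k} \<subseteq> T"
        using pos_less[OF ab] t(2,3) by (metis image_subsetI lessThan_iff nth_mem)
      fix i j assume "i < j" "j < k"
      then have W: "(i, j) \<in> W"
        by (simp add: W_def)
      then have inE: "(t ! pos (a, b) i, t ! pos (a, b) j) \<in> E (a, b)"
        by (force simp: E_def)
      have "(t ! pos (a, b) i, t ! pos (a, b) j) \<in> Q (a, b) \<longleftrightarrow> (i, j) \<in> P"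
      proof
        assume "(t ! pos (a, b) i, t ! pos (a, b) j) \<in> Q (a, b)"
        then obtain i' j' where ij: "(i', j') \<in> W" "(i', j') \<in> P"
          "t ! pos (a, b) i = t ! pos (a, b) i'" "t ! pos (a, b) j = t ! pos (a, b) j'"
          by (auto simp: Q_def)
        with eq_lines[OF ij(3,4) W ij(1) l l] show "(i, j) \<in> P"
          by simp
      qed (use W in \<open>force simp: Q_def\<close>)
      with eq inE show "(t ! pos (a, b) i, t ! pos (a, b) j) \<in> R \<longleftrightarrow> (i, j) \<in> P"
        by blast
    qed
    with np show False
      by simp
  qed
  then have "card {R. R \<subseteq> U \<and> \<not> contains_pattern k P R T} \<le> card {R. R \<subseteq> U \<and> (\<forall>l\<in>I. R \<inter> E l \<noteq> Q l)}"
    using assms(1) by (intro card_mono) auto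
  then have "real (card {R. R \<subseteq> U \<and> \<not> contains_pattern k P R T})
      \<le> real (card {R. R \<subseteq> U \<and> (\<forall>l\<in>I. R \<inter> E l \<noteq> Q l)})"
    by simp
  also have "real (card {R. R \<subseteq> U \<and> (\<forall>l\<in>I. R \<inter> E l \<noteq> Q l)}) = 2 ^ card U * (1 - 1 / 2 ^ e) ^ card I"
  proof (rule card_subsets_avoiding)
    show "finite I" "finite U"
      using assms(1) by (simp_all add: I_def)
    fix l assume l: "l \<in> I"
    then obtain a b where ab: "l = (a, b)" "a < q" "b < q"
      by (auto simp: I_def)
    have "(t ! pos l i, t ! pos l j) \<in> U" if "(i, j) \<in> W" for i j
    proof -
      have "t ! pos l i \<in> T" "t ! pos l j \<in> T"
        using that pos_less ab t(2,3) by (auto simp: W_def)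
      then show ?thesis
        using assms(2) by blast
    qed
    then show "E l \<subseteq> U"
      by (auto simp: E_def)
    have "inj_on (\<lambda>(i, j). (t ! pos l i, t ! pos l j)) W"
    proof (rule inj_onI, clarify)
      fix i j i' j' assume "(i, j) \<in> W" "(i', j') \<in> W"
        "t ! pos l i = t ! pos l i'" "t ! pos l j = t ! pos l j'"
      with eq_lines[of a b i a b i' j j'] l ab(1) show "i = i' \<and> j = j'"
        by simp
    qed
    then show "card (E l) = e"
      by (simp add: E_def card_image e W_def)
    show "Q l \<subseteq> E l"
      by (auto simp: E_def Q_def)
  next
    show "disjoint_family_on E I"
      unfolding disjoint_family_on_def
    proof (intro ballI impI equals0I)
      fix l m x assume lm: "l \<in> I" "m \<in> I" "l \<noteq> m" and x: "x \<in> E l \<inter> E m"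
      obtain a b c d where ab: "l = (a, b)" "m = (c, d)"
        by (metis surj_pair)
      obtain i j i' j' where "(i, j) \<in> W" "(i', j') \<in> W"
        "x = (t ! pos l i, t ! pos l j)" "x = (t ! pos m i', t ! pos m j')"
        using x by (auto simp: E_def)
      with eq_lines[of a b i c d i' j j'] lm ab show False
        by simp
    qed
  qed
  also have "card I = q * q"
    by (simp add: I_def)
  finally show ?thesis .
qed


text \<open>Union bound: there are fewer than \<open>2 ^ (L * s)\<close> sets of size
  \<open>s\<close>, and each is avoided by at most a fraction \<open>(1 / 2) ^ (L * s)\<close> of
  all relations. With \<open>q = k * k * L * 2 ^ e\<close> and \<open>s = k * k * q\<close>, the
  number of lines is \<open>q * q = 2 ^ e * (L * s)\<close>, and every \<open>2 ^ e\<close> lines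
  halve the fraction. So \<open>s\<close> is linear in \<open>L\<close>.\<close>

lemma ex_pattern_rich_relation:
  assumes "0 < k" "0 < L" "n < 2 ^ L"
    and e: "e = card {(i, j). i < j \<and> j < k}" and s: "s = k * k * (k * k * L * 2 ^ e)"
  shows "\<exists>R. \<forall>T\<subseteq>{..<n}. s \<le> card T \<longrightarrow> contains_pattern k P R T"
proof -
  define q where "q = k * k * L * 2 ^ e"
  define U where "U = {..<n} \<times> {..<n}"
  define F where "F = {T. T \<subseteq> {..<n} \<and> card T = s}"
  define avoid where "avoid = (\<lambda>T. {R. R \<subseteq> U \<and> \<not> contains_pattern k P R T})"
  have s_pos: "0 < s"
    using assms(1,2) by (simp add: s)
  have fU: "finite U"
    by (simp add: U_def)
  have "finite F"
    by (simp add: F_def)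
  have "q * q = 2 ^ e * (k * k * L * q)"
    by (simp add: q_def)
  then have "(1 - 1 / 2 ^ e) ^ (q * q) = ((1 - 1 / 2 ^ e :: real) ^ (2 ^ e)) ^ (k * k * L * q)"
    by (simp only: power_mult)
  also have "\<dots> \<le> (1 / 2) ^ (k * k * L * q)"
    using one_minus_inverse_power_le_half[of "2 ^ e"] by (intro power_mono) simp_all
  also have "k * k * L * q = L * s"
    by (simp add: q_def s)
  finally have prob: "(1 - 1 / 2 ^ e) ^ (q * q) \<le> (1 / 2 :: real) ^ (L * s)" .
  have avoid_le: "real (card (avoid T)) \<le> 2 ^ card U * (1 / 2) ^ (L * s)" if "T \<in> F" for T
  proof -
    have T: "T \<subseteq> {..<n}" "card T = k * k * q"
      using that by (simp_all add: F_def q_def s)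
    have "real (card (avoid T)) \<le> 2 ^ card U * (1 - 1 / 2 ^ e) ^ (q * q)"
      unfolding avoid_def
      by (rule card_avoiding_pattern[OF fU _ _ T(2) assms(1) e])
         (use T(1) finite_subset in \<open>auto simp: U_def\<close>)
    also have "\<dots> \<le> 2 ^ card U * (1 / 2) ^ (L * s)"
      using prob by (intro mult_left_mono) auto
    finally show ?thesis .
  qed
  have card_F: "card F < 2 ^ (L * s)"
  proof (cases "s \<le> n")
    case True
    have "card F = n choose s"
      using n_subsets[of "{..<n}" s] by (simp add: F_def)
    also have "\<dots> \<le> n ^ s"
      using True by (rule binomial_le_pow)
    also have "\<dots> < (2 ^ L) ^ s"
      using assms(3) s_pos by (intro power_strict_mono) auto
    finally show ?thesis
      by (simp add: power_mult)
  next
    case False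
    then have "F = {}"
      using subset_eq_atLeast0_lessThan_card by (force simp: F_def lessThan_atLeast0)
    then show ?thesis
      by simp
  qed
  have "real (card (\<Union>T\<in>F. avoid T)) \<le> (\<Sum>T\<in>F. real (card (avoid T)))"
    using card_UN_le[OF \<open>finite F\<close>, of avoid] by (simp flip: of_nat_sum)
  also have "\<dots> \<le> real (card F) * (2 ^ card U * (1 / 2) ^ (L * s))"
    using avoid_le by (rule sum_bounded_above)
  also have "\<dots> < 2 ^ (L * s) * (2 ^ card U * (1 / 2) ^ (L * s))"
  proof (rule mult_strict_right_mono)
    show "real (card F) < 2 ^ (L * s)"
      using card_F by (metis of_nat_less_numeral_power_cancel_iff)
  qed simp
  also have "\<dots> = real (card (Pow U))"
    using fU by (simp add: card_Pow power_one_over)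
  finally have "(\<Union>T\<in>F. avoid T) \<noteq> Pow U"
    by auto
  then obtain R where R: "R \<subseteq> U" "\<And>T. T \<in> F \<Longrightarrow> R \<notin> avoid T"
    by (auto simp: avoid_def)
  have "contains_pattern k P R T" if "T \<subseteq> {..<n}" "s \<le> card T" for T
  proof -
    obtain T' where T': "T' \<subseteq> T" "card T' = s"
      using \<open>s \<le> card T\<close> by (meson obtain_subset_with_card_n)
    then have "contains_pattern k P R T'"
      using R(1) R(2)[of T'] that(1) by (auto simp: F_def avoid_def)
    with T'(1) show ?thesis
      unfolding contains_pattern_def by (meson order_trans)
  qed
  then show ?thesis
    by blast
qed

section \<open>The two online problems\<close>

text \<open>Symmetry and irreflexivity of the arcs leave only the pairs \<open>u < v\<close> to
  check, which are those described by the requests.\<close>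

lemma hereditary_embed_strict_mono:
  fixes f :: "nat \<Rightarrow> nat"
  assumes "graph_property \<pi>" "hereditary \<pi>" "G \<in> \<pi>" "pair_graph H"
    and mono: "strict_mono_on (pverts H) f" and sub: "f ` pverts H \<subseteq> pverts G"
    and arcs: "\<And>u v. u \<in> pverts H \<Longrightarrow> v \<in> pverts H \<Longrightarrow> u < v \<Longrightarrow> (f u, f v) \<in> parcs G \<longleftrightarrow> (u, v) \<in> parcs H"
  shows "H \<in> \<pi>"
proof (rule hereditary_embed[OF assms(1-4) strict_mono_on_imp_inj_on[OF mono] sub])
  have G: "sym (parcs G)" "irrefl (parcs G)"
    using graph_propertyD(1)[OF assms(1,3)] by (simp_all add: pair_graph_iff)
  have H: "sym (parcs H)" "irrefl (parcs H)"
    using assms(4) by (simp_all add: pair_graph_iff)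
  fix u v assume uv: "u \<in> pverts H" "v \<in> pverts H"
  consider "u < v" | "u = v" | "v < u"
    by linarith
  then show "(f u, f v) \<in> parcs G \<longleftrightarrow> (u, v) \<in> parcs H"
  proof cases
    case 2
    then show ?thesis
      using G(2) H(2) by (simp add: irrefl_def)
  next
    case 3
    then show ?thesis
      using arcs[OF uv(2,1)] G(1) H(1) by (meson symD)
  qed (use arcs uv in blast)
qed

lemma kept_subset: "kept ys t \<subseteq> {..<t}"
  by (induction t) auto

text \<open>Step \<open>t\<close> can add no vertex other than \<open>t\<close>, so a lost vertex
  never returns.\<close>

lemma kept_antimono: "t \<le> t' \<Longrightarrow> v < t \<Longrightarrow> v \<in> kept ys t' \<Longrightarrow> v \<in> kept ys t"
  by (induction t' rule: dec_induct) (auto split: if_splits)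

lemma kept_cong: "(\<And>t. t < m \<Longrightarrow> ys ! t = zs ! t) \<Longrightarrow> kept ys m = kept zs m"
  by (induction m) auto

declare kept.simps(2) [simp del]

lemma max_preempt_simps:
  "inputs (max_preempt \<pi>) = {I. \<forall>i<length I. I ! i \<subseteq> {..<i}}"
  "input_length (max_preempt \<pi>) = length"
  "feasible (max_preempt \<pi>) I ys \<longleftrightarrow> (\<forall>t<length I. pair_induce (input_graph I) (kept ys (Suc t)) \<in> \<pi>)"
  "profit (max_preempt \<pi>) I ys = card (kept ys (length I))"
  by (simp_all add: max_preempt_def)

lemma anti_sgkh_simps:
  "inputs (anti_sgkh k) = {n # xs | n xs. length xs = n \<and> set xs \<subseteq> {1..k}}"
  "input_length (anti_sgkh k) I = length I - 1"
  "feasible (anti_sgkh k) I ys \<longleftrightarrow> set ys \<subseteq> {1..k}"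
  "profit (anti_sgkh k) I ys = card {i \<in> {1..length I - 1}. ys ! (i - 1) \<noteq> I ! i}"
  by (simp_all add: anti_sgkh_def)

lemma profit_le_opt_max_preempt:
  assumes "length ys = length I" "feasible (max_preempt \<pi>) I ys"
  shows "profit (max_preempt \<pi>) I ys \<le> opt (max_preempt \<pi>) I"
  unfolding opt_def
proof (rule Max_ge)
  \<comment> \<open>Answers contain arbitrary sets of numbers, so finiteness has to come from the
    bounded profits, not from the answer lists.\<close>
  have "profit (max_preempt \<pi>) I ys' \<le> length I" for ys'
    using card_mono[OF _ kept_subset, of "length I" ys'] by (simp add: max_preempt_simps)
  then have "{profit (max_preempt \<pi>) I ys |ys. length ys = input_length (max_preempt \<pi>) I \<and>
      feasible (max_preempt \<pi>) I ys} \<subseteq> {..length I}"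
    by blast
  then show "finite {profit (max_preempt \<pi>) I ys |ys. length ys = input_length (max_preempt \<pi>) I \<and>
      feasible (max_preempt \<pi>) I ys}"
    using finite_subset by blast
  show "profit (max_preempt \<pi>) I ys \<in> {profit (max_preempt \<pi>) I ys |ys.
      length ys = input_length (max_preempt \<pi>) I \<and> feasible (max_preempt \<pi>) I ys}"
    using assms by (auto simp only: max_preempt_simps(2))
qed

text \<open>Passes from positions \<open>1..n\<close> in the input to indices
  \<open>0..n - 1\<close> in \<open>xs\<close>, which are also the block numbers.\<close>

lemma profit_anti_sgkh:
  assumes "length xs = n"
  shows "profit (anti_sgkh k) (n # xs) ys = card {j. j < n \<and> ys ! j \<noteq> xs ! j}"
proof -
  have "{i \<in> {1..n}. ys ! (i - 1) \<noteq> (n # xs) ! i} = Suc ` {j. j < n \<and> ys ! j \<noteq> xs ! j}"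
  proof (intro equalityI subsetI)
    fix i assume "i \<in> {i \<in> {1..n}. ys ! (i - 1) \<noteq> (n # xs) ! i}"
    then show "i \<in> Suc ` {j. j < n \<and> ys ! j \<noteq> xs ! j}"
      by (cases i) auto
  qed auto
  then show ?thesis
    using assms by (simp add: anti_sgkh_simps card_image)
qed

lemma opt_anti_sgkh_le:
  assumes "length xs = n" "0 < k"
  shows "opt (anti_sgkh k) (n # xs) \<le> n"
  unfolding opt_def
proof (rule Max.boundedI)
  let ?A = "{profit (anti_sgkh k) (n # xs) ys |ys.
       length ys = input_length (anti_sgkh k) (n # xs) \<and> feasible (anti_sgkh k) (n # xs) ys}"
  have le: "a \<le> n" if a: "a \<in> ?A" for a
  proof -
    obtain ys where "a = profit (anti_sgkh k) (n # xs) ys"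
      using a by blast
    then have "a = card {j. j < n \<and> ys ! j \<noteq> xs ! j}"
      using profit_anti_sgkh[OF assms(1)] by simp
    then show ?thesis
      using card_mono[of "{..<n}" "{j. j < n \<and> ys ! j \<noteq> xs ! j}"] by auto
  qed
  then show "finite ?A"
    by (meson finite_nat_set_iff_bounded_le)
  \<comment> \<open>A constant guess witnesses that \<open>Max\<close> is taken over a nonempty set;
    the symbol 1 exists because \<open>0 < k\<close>.\<close>
  have "length (replicate n 1) = input_length (anti_sgkh k) (n # xs)"
    "feasible (anti_sgkh k) (n # xs) (replicate n 1)"
    using assms by (auto simp: anti_sgkh_simps)
  then show "?A \<noteq> {}"
    by blast
  show "a \<le> n" if "a \<in> ?A" for a
    using le that .
qed

text \<open>The advice is read as \<open>M\<close> binary numbers of exactly \<open>L\<close> bits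
  each, least significant bit first. The fixed format makes delimiters unnecessary.\<close>

definition marked :: "nat \<Rightarrow> nat \<Rightarrow> advice \<Rightarrow> nat set" where
  "marked M L \<phi> = (\<lambda>r. horner_sum of_bool 2 (map (\<lambda>t. \<phi> (r * L + t)) [0..<L])) ` {..<M}"

lemma marked_cong: "(\<And>j. j < M * L \<Longrightarrow> \<psi> j = \<phi> j) \<Longrightarrow> marked M L \<psi> = marked M L \<phi>"
proof -
  assume eq: "\<And>j. j < M * L \<Longrightarrow> \<psi> j = \<phi> j"
  have "r * L + t < M * L" if "r < M" "t < L" for r t
  proof -
    have "r * L + t < Suc r * L"
      using that by simp
    also have "\<dots> \<le> M * L"
      using that by (intro mult_le_mono1) simp
    finally show ?thesis .
  qed
  then have "map (\<lambda>t. \<psi> (r * L + t)) [0..<L] = map (\<lambda>t. \<phi> (r * L + t)) [0..<L]" if "r < M" for r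
    using eq that by simp
  then show ?thesis
    unfolding marked_def by (metis (no_types, lifting) image_cong lessThan_iff)
qed

(* The value 0, which marks no position, pads D to M numbers. *)
lemma ex_marked:
  assumes "D \<subseteq> {1..n}" "card D \<le> M" "n < 2 ^ L"
  obtains \<phi> where "marked M L \<phi> \<inter> {1..n} = D"
proof -
  have fin: "finite D"
    using assms(1) finite_subset by blast
  then obtain h where h: "bij_betw h {..<card D} D"
    using ex_bij_betw_nat_finite by (metis atLeast0LessThan)
  define f where "f = (\<lambda>r. if r < card D then h r else 0)"
  have f_le: "f r \<le> n" for r
  proof (cases "r < card D")
    case True
    then have "h r \<in> D"
      using h by (auto simp: bij_betw_def)
    with True assms(1) show ?thesis
      by (auto simp: f_def)
  qed (simp add: f_def)
  define \<phi> where "\<phi> = (\<lambda>j. bit (f (j div L)) (j mod L))"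
  have "horner_sum of_bool 2 (map (\<lambda>t. \<phi> (r * L + t)) [0..<L]) = f r" for r
  proof -
    have "map (\<lambda>t. \<phi> (r * L + t)) [0..<L] = map (bit (f r)) [0..<L]"
      by (simp add: \<phi>_def)
    moreover have "f r < 2 ^ L"
      using f_le[of r] assms(3) by simp
    ultimately show ?thesis
      by (simp only: horner_sum_bit_eq_take_bit take_bit_nat_eq_self)
  qed
  then have "marked M L \<phi> = f ` {..<M}"
    by (simp add: marked_def)
  also have "\<dots> \<inter> {1..n} = D"
  proof (intro equalityI subsetI)
    fix x assume "x \<in> f ` {..<M} \<inter> {1..n}"
    then show "x \<in> D"
      using h by (auto simp: f_def bij_betw_def split: if_splits)
  next
    fix x assume x: "x \<in> D"
    then obtain r where "r < card D" "x = h r"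
      using h by (auto simp: bij_betw_def)
    then have "x = f r" "r < M"
      using assms(2) by (simp_all add: f_def)
    with x assms(1) show "x \<in> f ` {..<M} \<inter> {1..n}"
      by blast
  qed
  finally show ?thesis
    using that by blast
qed

section \<open>The reduction\<close>

text \<open>\<open>G n\<close> joins good vertices and \<open>R n\<close> joins bad ones;
  \<open>L n\<close> bits hold any number up to \<open>n\<close>. Monotonicity is assumed because
  competitiveness at \<open>N\<close> covers all inputs of length \<open>n \<le> N\<close>, whose
  extra advice must fit the bound for \<open>N\<close>.\<close>

locale anti_guessing_reduction =
  fixes \<pi> :: "nat pair_pre_digraph set" and k :: nat and H :: "nat pair_pre_digraph"
    and G :: "nat \<Rightarrow> nat pair_pre_digraph" and R :: "nat \<Rightarrow> nat rel" and s L :: "nat \<Rightarrow> nat"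
  assumes gp: "graph_property \<pi>" and her: "hereditary \<pi>" and k2: "2 \<le> k"
    and H: "pair_graph H" "pverts H = {..<k}" "H \<notin> \<pi>"
    and G: "G n \<in> \<pi>" "pverts (G n) = {..<n}"
    and R: "T \<subseteq> {..<n} \<Longrightarrow> s n \<le> card T \<Longrightarrow> contains_pattern k (parcs H) (R n) T"
    and L: "n < 2 ^ L n" and mono_s: "mono s" and mono_L: "mono L"
begin

text \<open>
  Vertex \<open>v\<close> is vertex \<open>v mod k\<close> of the copy of \<open>H\<close> that makes up block \<open>v div k\<close>. It is good if
  \<open>v mod k + 1\<close> is the symbol \<open>x\<^sub>i\<close> with \<open>i = v div k + 1\<close>; this only becomes relevant in later
  blocks, when \<open>x\<^sub>i\<close> is known.
\<close>

definition good :: "nat list \<Rightarrow> nat \<Rightarrow> bool" where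
  "good xs v \<longleftrightarrow> xs ! (v div k) = v mod k + 1"

text \<open>Meant for \<open>u < v\<close>. Across blocks only the earlier vertex decides which
  relation applies, since its symbol is already revealed when the later block is built.\<close>

definition adj :: "nat \<Rightarrow> nat list \<Rightarrow> nat \<Rightarrow> nat \<Rightarrow> bool" where
  "adj n xs u v \<longleftrightarrow>
     (if u div k = v div k then (u mod k, v mod k) \<in> parcs H
      else if good xs u then (u div k, v div k) \<in> parcs (G n)
      else (u div k, v div k) \<in> R n)"

definition requests :: "nat \<Rightarrow> nat list \<Rightarrow> nat \<Rightarrow> nat set list" where
  "requests n xs m = map (\<lambda>v. {u. u < v \<and> adj n xs u v}) [0..<m]"

definition kept_by :: "(nat set, bool \<times> nat set) online_alg \<Rightarrow> advice \<Rightarrow> nat \<Rightarrow> nat list \<Rightarrow> nat \<Rightarrow> nat set" where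
  "kept_by A \<phi> n xs m = kept (run (max_preempt \<pi>) A \<phi> (requests n xs m)) m"

text \<open>The guess for \<open>xs ! j\<close> is made once block \<open>j\<close> is complete,
  that is, after \<open>Suc j * k\<close> vertices. The outer \<open>Suc\<close> turns a position
  below \<open>k\<close> into a symbol in \<open>{1..k}\<close>.\<close>

definition guess :: "(nat set, bool \<times> nat set) online_alg \<Rightarrow> advice \<Rightarrow> nat \<Rightarrow> nat list \<Rightarrow> nat \<Rightarrow> nat" where
  "guess A \<phi> n xs j = Suc (SOME p. p < k \<and> j * k + p \<notin> kept_by A \<phi> n xs (Suc j * k))"

definition extra_bits :: "nat \<Rightarrow> nat" where
  "extra_bits n = k * s n * L n"

text \<open>The first \<open>extra_bits n\<close> bits list the positions to repair and the
  remaining ones are passed to \<open>A\<close>. Positions are listed as \<open>Suc j\<close>, so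
  that the number 0 stays free. The replacement \<open>y mod k + 1\<close> is the cyclic successor
  of \<open>y\<close> in \<open>{1..k}\<close>.\<close>

definition guesser :: "(nat set, bool \<times> nat set) online_alg \<Rightarrow> (nat, nat) online_alg" where
  "guesser A \<phi> ws =
     (let n = hd ws; xs = tl ws; j = length xs; y = guess A (\<lambda>t. \<phi> (extra_bits n + t)) n xs j
      in if Suc j \<in> marked (k * s n) (L n) \<phi> then y mod k + 1 else y)"

section \<open>The constructed instance and the run of the graph algorithm on it\<close>

lemma k_pos: "0 < k"
  using k2 by simp

lemma div_mod_block [simp]: "p < k \<Longrightarrow> (j * k + p) div k = j" "p < k \<Longrightarrow> (j * k + p) mod k = p"
  by simp_all

lemma length_requests [simp]: "length (requests n xs m) = m"
  by (simp add: requests_def)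

lemma take_requests: "t \<le> m \<Longrightarrow> take t (requests n xs m) = requests n xs t"
  by (simp add: requests_def take_map)

lemma requests_in_inputs: "requests n xs m \<in> inputs (max_preempt \<pi>)"
  by (auto simp: max_preempt_simps requests_def)

lemma pverts_input_graph_requests: "pverts (input_graph (requests n xs m)) = {..<m}"
  by (simp add: input_graph_def)

lemma parcs_input_graph_requests:
  "u < v \<Longrightarrow> v < m \<Longrightarrow> (u, v) \<in> parcs (input_graph (requests n xs m)) \<longleftrightarrow> adj n xs u v"
  by (auto simp: input_graph_def requests_def)

lemma pair_graph_input_graph_requests: "pair_graph (input_graph (requests n xs m))"
  unfolding pair_graph_iff
  by (auto simp: input_graph_def requests_def sym_def irrefl_def)

text \<open>Within block \<open>j\<close> the adjacency is that of \<open>H\<close>, and edges from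
  earlier blocks depend on their symbols only. So block \<open>j\<close> can be presented before
  \<open>xs ! j\<close> is known.\<close>

lemma requests_cong:
  assumes "\<And>i. i < j \<Longrightarrow> xs ! i = ys ! i"
  shows "requests n xs (Suc j * k) = requests n ys (Suc j * k)"
proof -
  have "adj n xs u v = adj n ys u v" if "u < v" "v < Suc j * k" for u v
  proof (cases "u div k = v div k")
    case False
    moreover have "u div k \<le> v div k" "v div k < Suc j"
      using that div_le_mono less_mult_imp_div_less by (simp, blast)
    ultimately show ?thesis
      using assms by (simp add: adj_def good_def)
  qed (simp add: adj_def)
  then show ?thesis
    unfolding requests_def by (intro map_cong) auto
qed

lemma run_requests_nth:
  "t < m \<Longrightarrow> run (max_preempt \<pi>) A \<phi> (requests n xs m) ! t = A \<phi> (requests n xs (Suc t))"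
  by (simp add: run_def max_preempt_simps take_requests del: upt_Suc)

text \<open>Answers depend on prefixes of the requests, so one run on the whole graph yields the
  kept sets behind all guesses.\<close>

lemma kept_by_prefix:
  "t \<le> m \<Longrightarrow> kept_by A \<phi> n xs t = kept (run (max_preempt \<pi>) A \<phi> (requests n xs m)) t"
  unfolding kept_by_def by (intro kept_cong) (simp add: run_requests_nth)

lemma kept_by_subset: "kept_by A \<phi> n xs m \<subseteq> {..<m}"
  unfolding kept_by_def by (rule kept_subset)

lemma kept_by_antimono:
  "t \<le> m \<Longrightarrow> v < t \<Longrightarrow> v \<in> kept_by A \<phi> n xs m \<Longrightarrow> v \<in> kept_by A \<phi> n xs t"
  unfolding kept_by_prefix[of t m] kept_by_def[of _ _ _ _ m] by (rule kept_antimono)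

lemma kept_by_feasible:
  assumes "online_algorithm (max_preempt \<pi>) A" "0 < m"
  shows "pair_induce (input_graph (requests n xs m)) (kept_by A \<phi> n xs m) \<in> \<pi>"
proof -
  have "feasible (max_preempt \<pi>) (requests n xs m) (run (max_preempt \<pi>) A \<phi> (requests n xs m))"
    using assms(1) requests_in_inputs by (simp add: online_algorithm_def)
  then have "\<forall>t<m. pair_induce (input_graph (requests n xs m))
      (kept (run (max_preempt \<pi>) A \<phi> (requests n xs m)) (Suc t)) \<in> \<pi>"
    by (simp add: max_preempt_simps)
  from this[rule_format, of "m - 1"] assms(2) show ?thesis
    by (simp add: kept_by_def)
qed

text \<open>Applied to the vertices of a single block, and to bad vertices from \<open>k\<close>
  different blocks.\<close>

lemma no_copy_of_H:
  assumes "pair_induce (input_graph (requests n xs m)) S \<in> \<pi>"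
    and "strict_mono_on {..<k} f" "f ` {..<k} \<subseteq> S" "S \<subseteq> {..<m}"
    and adj: "\<And>i j. i < j \<Longrightarrow> j < k \<Longrightarrow> adj n xs (f i) (f j) \<longleftrightarrow> (i, j) \<in> parcs H"
  shows False
proof -
  have "H \<in> \<pi>"
  proof (rule hereditary_embed_strict_mono[OF gp her assms(1) H(1)])
    fix i j assume ij: "i \<in> pverts H" "j \<in> pverts H" "i < j"
    then have S: "f i \<in> S" "f j \<in> S" "f i < f j"
      using assms(2,3) H(2) by (auto simp: strict_mono_on_def)
    then have "(f i, f j) \<in> parcs (input_graph (requests n xs m)) \<longleftrightarrow> adj n xs (f i) (f j)"
      using assms(4) by (intro parcs_input_graph_requests) auto
    then show "(f i, f j) \<in> parcs (pair_induce (input_graph (requests n xs m)) S) \<longleftrightarrow> (i, j) \<in> parcs H"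
      using S ij adj H(2) by (simp add: pair_induce_def)
  qed (use assms H(2) in \<open>simp_all add: pair_induce_def\<close>)
  with H(3) show False
    by simp
qed

lemma ex_dropped_in_block:
  assumes "online_algorithm (max_preempt \<pi>) A"
  shows "\<exists>p<k. j * k + p \<notin> kept_by A \<phi> n xs (Suc j * k)"
proof (rule ccontr)
  assume "\<not> ?thesis"
  then have "(\<lambda>p. j * k + p) ` {..<k} \<subseteq> kept_by A \<phi> n xs (Suc j * k)"
    by auto
  moreover have "0 < Suc j * k"
    using k_pos by simp
  ultimately show False
    by (intro no_copy_of_H[OF kept_by_feasible[OF assms] _ _ kept_by_subset])
       (auto simp: strict_mono_on_def adj_def)
qed

lemma guess_props:
  assumes "online_algorithm (max_preempt \<pi>) A"
  shows "guess A \<phi> n xs j \<in> {1..k}"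
    and "j * k + (guess A \<phi> n xs j - 1) \<notin> kept_by A \<phi> n xs (Suc j * k)"
proof -
  define p where "p = (SOME p. p < k \<and> j * k + p \<notin> kept_by A \<phi> n xs (Suc j * k))"
  have "p < k \<and> j * k + p \<notin> kept_by A \<phi> n xs (Suc j * k)"
    unfolding p_def using ex_dropped_in_block[OF assms] by (rule someI_ex)
  moreover have "guess A \<phi> n xs j = Suc p"
    by (simp only: guess_def p_def)
  ultimately show "guess A \<phi> n xs j \<in> {1..k}"
    and "j * k + (guess A \<phi> n xs j - 1) \<notin> kept_by A \<phi> n xs (Suc j * k)"
    by simp_all
qed

lemma guess_cong: "(\<And>i. i < j \<Longrightarrow> xs ! i = ys ! i) \<Longrightarrow> guess A \<phi> n xs j = guess A \<phi> n ys j"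
  using requests_cong[of j xs ys n] by (simp only: guess_def kept_by_def)

lemma guess_cong_run:
  assumes "run (max_preempt \<pi>) A \<psi> (requests n xs m) = run (max_preempt \<pi>) A \<phi> (requests n xs m)"
    and "Suc j * k \<le> m"
  shows "guess A \<psi> n xs j = guess A \<phi> n xs j"
  unfolding guess_def kept_by_prefix[OF assms(2)] assms(1) ..

section \<open>Answers of the guesser and the advice it reads\<close>

lemma length_run_guesser [simp]:
  "length xs = n \<Longrightarrow> length (run (anti_sgkh k) (guesser A) \<phi> (n # xs)) = n"
  by (simp add: run_def anti_sgkh_simps)

lemma run_guesser_nth:
  assumes "length xs = n" "j < n"
  shows "run (anti_sgkh k) (guesser A) \<phi> (n # xs) ! j =
    (let y = guess A (\<lambda>t. \<phi> (extra_bits n + t)) n xs j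
     in if Suc j \<in> marked (k * s n) (L n) \<phi> then y mod k + 1 else y)"
proof -
  have "run (anti_sgkh k) (guesser A) \<phi> (n # xs) ! j = guesser A \<phi> (n # take j xs)"
    using assms by (simp add: run_def anti_sgkh_simps del: upt_Suc)
  moreover have "guess A \<psi> n (take j xs) j = guess A \<psi> n xs j" for \<psi>
    by (rule guess_cong) simp
  ultimately show ?thesis
    using assms by (simp add: guesser_def)
qed

lemma online_algorithm_guesser:
  assumes "online_algorithm (max_preempt \<pi>) A"
  shows "online_algorithm (anti_sgkh k) (guesser A)"
  unfolding online_algorithm_def
proof (intro allI ballI)
  fix \<phi> I assume "I \<in> inputs (anti_sgkh k)"
  then obtain n xs where I: "I = n # xs" "length xs = n"
    by (auto simp: anti_sgkh_simps)
  have "run (anti_sgkh k) (guesser A) \<phi> (n # xs) ! j \<in> {1..k}" if "j < n" for j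
    unfolding run_guesser_nth[OF I(2) that] Let_def
    using guess_props(1)[OF assms] mod_less_divisor[OF k_pos] by (auto simp: Suc_le_eq)
  then have "set (run (anti_sgkh k) (guesser A) \<phi> (n # xs)) \<subseteq> {1..k}"
    using I(2) by (auto simp: in_set_conv_nth)
  then show "feasible (anti_sgkh k) I (run (anti_sgkh k) (guesser A) \<phi> I)"
    by (simp add: I(1) anti_sgkh_simps)
qed

text \<open>All guesses are determined by one run of \<open>A\<close> on the full graph, so the bits
  read in that run are counted once, after the list of repairs.\<close>

lemma reads_at_most_guesser:
  assumes "length xs = n" "reads_at_most (max_preempt \<pi>) A (\<lambda>t. \<phi> (extra_bits n + t)) (requests n xs (n * k)) m"
    and "m + extra_bits n \<le> m'"
  shows "reads_at_most (anti_sgkh k) (guesser A) \<phi> (n # xs) m'"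
  unfolding reads_at_most_def
proof (intro allI impI)
  fix \<psi> assume eq: "\<forall>j<m'. \<psi> j = \<phi> j"
  have "run (max_preempt \<pi>) A (\<lambda>t. \<psi> (extra_bits n + t)) (requests n xs (n * k)) =
      run (max_preempt \<pi>) A (\<lambda>t. \<phi> (extra_bits n + t)) (requests n xs (n * k))"
    by (rule assms(2)[unfolded reads_at_most_def, rule_format]) (use eq assms(3) in simp)
  note guess_eq = guess_cong_run[OF this]
  have marked_eq: "marked (k * s n) (L n) \<psi> = marked (k * s n) (L n) \<phi>"
    using eq assms(3) by (intro marked_cong) (simp add: extra_bits_def)
  have "run (anti_sgkh k) (guesser A) \<psi> (n # xs) ! j = run (anti_sgkh k) (guesser A) \<phi> (n # xs) ! j"
    if "j < n" for j
  proof -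
    have "Suc j * k \<le> n * k"
      using that by (intro mult_le_mono1) simp
    then show ?thesis
      by (simp only: run_guesser_nth[OF assms(1) that] guess_eq marked_eq)
  qed
  then show "run (anti_sgkh k) (guesser A) \<psi> (n # xs) = run (anti_sgkh k) (guesser A) \<phi> (n # xs)"
    using assms(1) by (intro nth_equalityI) simp_all
qed

section \<open>Counting good and bad vertices\<close>

lemma good_eqI: "good xs u \<Longrightarrow> good xs v \<Longrightarrow> u div k = v div k \<Longrightarrow> u = v"
  unfolding good_def by (metis add_right_cancel div_mult_mod_eq)

lemma card_good:
  assumes "length xs = n" "set xs \<subseteq> {1..k}"
  shows "card {v. v < n * k \<and> good xs v} = n"
proof -
  have xs: "xs ! j \<in> {1..k}" if "j < n" for j
    using that assms nth_mem by blast
  have "bij_betw (\<lambda>v. v div k) {v. v < n * k \<and> good xs v} {..<n}"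
  proof (rule bij_betw_byWitness[where f' = "\<lambda>j. j * k + (xs ! j - 1)"])
    show "\<forall>v\<in>{v. v < n * k \<and> good xs v}. v div k * k + (xs ! (v div k) - 1) = v"
      by (simp add: good_def)
    have "xs ! j - 1 < k" if "j < n" for j
      using xs[OF that] by auto
    then show "\<forall>j\<in>{..<n}. (j * k + (xs ! j - 1)) div k = j"
      by simp
    show "(\<lambda>v. v div k) ` {v. v < n * k \<and> good xs v} \<subseteq> {..<n}"
      by (auto simp: less_mult_imp_div_less)
    show "(\<lambda>j. j * k + (xs ! j - 1)) ` {..<n} \<subseteq> {v. v < n * k \<and> good xs v}"
    proof (intro image_subsetI CollectI conjI)
      fix j assume j: "j \<in> {..<n}"
      then obtain p where p: "xs ! j = p + 1" "p < k"
        using xs[of j] by (cases "xs ! j") auto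
      have "j * k + (xs ! j - 1) < Suc j * k"
        using p by simp
      also have "\<dots> \<le> n * k"
        using j by (intro mult_le_mono1) simp
      finally show "j * k + (xs ! j - 1) < n * k" .
      show "good xs (j * k + (xs ! j - 1))"
        using p by (simp add: good_def)
    qed
  qed
  then show ?thesis
    using bij_betw_same_card by fastforce
qed

text \<open>The offline solution accepts exactly the good vertices and preempts nothing. They lie in
  different blocks, so mapping a vertex to its block number embeds the graph induced at any time
  into \<open>G n\<close>.\<close>

lemma opt_requests_ge:
  assumes "length xs = n" "set xs \<subseteq> {1..k}"
  shows "n \<le> opt (max_preempt \<pi>) (requests n xs (n * k))"
proof -
  define ys where "ys = map (\<lambda>v. (good xs v, {} :: nat set)) [0..<n * k]"
  have kept: "kept ys t = {v. v < t \<and> good xs v}" if "t \<le> n * k" for t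
    using that
  proof (induction t)
    case (Suc t)
    then have "kept ys (Suc t) = {v. v < t \<and> good xs v} \<union> (if good xs t then {t} else {})"
      by (simp add: ys_def kept.simps(2))
    then show ?case
      by (auto simp: less_Suc_eq)
  qed simp
  have "pair_induce (input_graph (requests n xs (n * k))) (kept ys (Suc t)) \<in> \<pi>" if "t < n * k" for t
  proof (rule hereditary_embed_strict_mono[OF gp her G(1)])
    let ?S = "{v. v < Suc t \<and> good xs v}"
    have S: "kept ys (Suc t) = ?S"
      using kept[of "Suc t"] that by simp
    have sub: "?S \<subseteq> {..<n * k}"
      using that by auto
    show "pair_graph (pair_induce (input_graph (requests n xs (n * k))) (kept ys (Suc t)))"
      using sub by (intro pair_graph_pair_induce pair_graph_input_graph_requests)
        (simp add: S pverts_input_graph_requests)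
    have less: "u div k < v div k" if "u < v" "good xs u" "good xs v" for u v
    proof (rule ccontr)
      assume "\<not> u div k < v div k"
      then have "u div k = v div k"
        using \<open>u < v\<close> div_le_mono[of u v k] by simp
      then have "u = v"
        using that(2,3) good_eqI by blast
      with that(1) show False
        by simp
    qed
    then show "strict_mono_on (pverts (pair_induce (input_graph (requests n xs (n * k))) (kept ys (Suc t)))) (\<lambda>v. v div k)"
      by (simp add: S pair_induce_def strict_mono_on_def)
    show "(\<lambda>v. v div k) ` pverts (pair_induce (input_graph (requests n xs (n * k))) (kept ys (Suc t)))
        \<subseteq> pverts (G n)"
      using sub by (auto simp: S pair_induce_def G(2) less_mult_imp_div_less)
    fix u v assume "u < v"
      and "u \<in> pverts (pair_induce (input_graph (requests n xs (n * k))) (kept ys (Suc t)))"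
      and "v \<in> pverts (pair_induce (input_graph (requests n xs (n * k))) (kept ys (Suc t)))"
    then have uv: "u < v" "u \<in> ?S" "v \<in> ?S"
      by (simp_all add: S pair_induce_def)
    then have "v < n * k"
      using sub by auto
    with uv less show "(u div k, v div k) \<in> parcs (G n) \<longleftrightarrow>
        (u, v) \<in> parcs (pair_induce (input_graph (requests n xs (n * k))) (kept ys (Suc t)))"
      by (simp add: S pair_induce_def parcs_input_graph_requests adj_def less_imp_neq)
  qed
  then have "profit (max_preempt \<pi>) (requests n xs (n * k)) ys \<le> opt (max_preempt \<pi>) (requests n xs (n * k))"
    by (intro profit_le_opt_max_preempt) (simp_all add: max_preempt_simps, simp add: ys_def)
  then show ?thesis
    using card_good[OF assms] kept[of "n * k"] by (simp add: max_preempt_simps)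
qed

text \<open>A good vertex that survives to the end was still kept when its block was completed. So
  it is not the dropped vertex that defines the guess, and the guess misses the symbol. Distinct
  good vertices belong to distinct blocks.\<close>

lemma card_kept_good_le:
  assumes "online_algorithm (max_preempt \<pi>) A"
  shows "card {v \<in> kept_by A \<phi> n xs (n * k). good xs v} \<le> card {j. j < n \<and> guess A \<phi> n xs j \<noteq> xs ! j}"
proof (rule card_inj_on_le[where f = "\<lambda>v. v div k"])
  show "inj_on (\<lambda>v. v div k) {v \<in> kept_by A \<phi> n xs (n * k). good xs v}"
    using good_eqI by (intro inj_onI) blast
  show "(\<lambda>v. v div k) ` {v \<in> kept_by A \<phi> n xs (n * k). good xs v} \<subseteq> {j. j < n \<and> guess A \<phi> n xs j \<noteq> xs ! j}"
  proof (intro image_subsetI CollectI conjI notI)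
    fix v assume "v \<in> {v \<in> kept_by A \<phi> n xs (n * k). good xs v}"
    then have v: "v \<in> kept_by A \<phi> n xs (n * k)" "xs ! (v div k) = v mod k + 1"
      by (simp_all add: good_def)
    then have "v < n * k"
      using kept_by_subset by blast
    then show j: "v div k < n"
      by (simp add: less_mult_imp_div_less)
    assume "guess A \<phi> n xs (v div k) = xs ! (v div k)"
    with v(2) have "v div k * k + (guess A \<phi> n xs (v div k) - 1) = v"
      by simp
    then have "v \<notin> kept_by A \<phi> n xs (Suc (v div k) * k)"
      using guess_props(2)[OF assms, of "v div k" \<phi> n xs] by metis
    moreover have "v \<in> kept_by A \<phi> n xs (Suc (v div k) * k)"
    proof (rule kept_by_antimono[OF _ _ v(1)])
      show "Suc (v div k) * k \<le> n * k"
        using j by (intro mult_le_mono1) simp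
      show "v < Suc (v div k) * k"
        using dividend_less_div_times[OF k_pos, of v] by simp
    qed
    ultimately show False
      by simp
  qed
qed simp

text \<open>If surviving bad vertices met more than \<open>s n\<close> blocks, \<open>R n\<close>
  would contain the pattern of \<open>H\<close> on those blocks. One bad vertex from each of its
  \<open>k\<close> blocks then induces \<open>H\<close>, since edges from a bad vertex to later
  blocks follow \<open>R n\<close>. The factor \<open>k\<close> counts the vertices of a
  block.\<close>

lemma card_kept_bad_le:
  assumes "online_algorithm (max_preempt \<pi>) A" "0 < n"
  shows "card {v \<in> kept_by A \<phi> n xs (n * k). \<not> good xs v} \<le> k * s n"
proof -
  let ?B = "{v \<in> kept_by A \<phi> n xs (n * k). \<not> good xs v}"
  let ?T = "(\<lambda>v. v div k) ` ?B"
  have fin: "finite ?B"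
    using finite_subset[OF kept_by_subset] by simp
  have T: "?T \<subseteq> {..<n}"
    by (auto dest!: subsetD[OF kept_by_subset] simp: less_mult_imp_div_less)
  have "card ?T \<le> s n"
  proof (rule ccontr)
    assume "\<not> card ?T \<le> s n"
    then have "contains_pattern k (parcs H) (R n) ?T"
      using R[OF T] by simp
    then obtain f where f: "strict_mono_on {..<k} f" "f ` {..<k} \<subseteq> ?T"
      "\<And>i j. i < j \<Longrightarrow> j < k \<Longrightarrow> (f i, f j) \<in> R n \<longleftrightarrow> (i, j) \<in> parcs H"
      unfolding contains_pattern_def by blast
    have "\<exists>v\<in>?B. v div k = f i" if "i < k" for i
      using f(2) that by force
    then obtain g where g: "\<And>i. i < k \<Longrightarrow> g i \<in> ?B" "\<And>i. i < k \<Longrightarrow> g i div k = f i"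
      by metis
    have less: "g i < g j" if "i < j" "j < k" for i j
    proof -
      have "g i div k < g j div k"
        using f(1) g(2) that by (simp add: strict_mono_on_def)
      then show ?thesis
        by (meson div_le_mono not_le)
    qed
    show False
    proof (rule no_copy_of_H[OF kept_by_feasible[OF assms(1)] _ _ kept_by_subset])
      show "0 < n * k"
        using assms(2) k_pos by simp
      show "strict_mono_on {..<k} g"
        using less by (simp add: strict_mono_on_def)
      show "g ` {..<k} \<subseteq> kept_by A \<phi> n xs (n * k)"
        using g(1) by blast
      fix i j assume ij: "i < j" "j < k"
      then have "f i < f j" "\<not> good xs (g i)"
        using f(1) g(1)[of i] by (simp_all add: strict_mono_on_def)
      then show "adj n xs (g i) (g j) \<longleftrightarrow> (i, j) \<in> parcs H"
        using f(3)[OF ij] g(2) ij by (simp add: adj_def)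
    qed
  qed
  have "?B \<subseteq> (\<lambda>(j, p). j * k + p) ` (?T \<times> {..<k})"
  proof
    fix v assume "v \<in> ?B"
    moreover have "v = (\<lambda>(j, p). j * k + p) (v div k, v mod k)"
      by simp
    ultimately show "v \<in> (\<lambda>(j, p). j * k + p) ` (?T \<times> {..<k})"
      using k_pos by (metis (no_types, lifting) SigmaI imageI lessThan_iff mod_less_divisor)
  qed
  then have "card ?B \<le> card (?T \<times> {..<k})"
    using fin by (meson finite_SigmaI finite_imageI finite_lessThan surj_card_le)
  also have "\<dots> \<le> s n * k"
    using \<open>card ?T \<le> s n\<close> by (simp only: card_cartesian_product card_lessThan mult_le_mono1)
  finally show ?thesis
    by (simp add: mult.commute)
qed

lemma card_kept_le:
  assumes "online_algorithm (max_preempt \<pi>) A" "0 < n"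
  shows "card (kept_by A \<phi> n xs (n * k)) \<le> card {j. j < n \<and> guess A \<phi> n xs j \<noteq> xs ! j} + k * s n"
proof -
  let ?K = "kept_by A \<phi> n xs (n * k)"
  have "?K = {v \<in> ?K. good xs v} \<union> {v \<in> ?K. \<not> good xs v}"
    by blast
  then have "card ?K \<le> card {v \<in> ?K. good xs v} + card {v \<in> ?K. \<not> good xs v}"
    by (metis card_Un_le)
  with card_kept_good_le[OF assms(1)] card_kept_bad_le[OF assms] show ?thesis
    by (meson add_mono order_trans)
qed

section \<open>Competitiveness of the guesser\<close>

lemma mono_extra_bits: "mono extra_bits"
  unfolding extra_bits_def by (intro monoI mult_le_mono monoD[OF mono_s] monoD[OF mono_L]) simp_all

text \<open>If the list has room for all wrong guesses, every answer misses its symbol and the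
  profit is \<open>n\<close>. Otherwise the list is full, and its \<open>k * s n\<close> repairs
  make up for the bad vertices that \<open>A\<close> keeps.\<close>

lemma competitive_guesser:
  assumes "competitive_with_advice (max_preempt \<pi>) A c b" "0 < c"
  shows "competitive_with_advice (anti_sgkh k) (guesser A) c (\<lambda>n. b (k * n) + extra_bits n)"
  unfolding competitive_with_advice_def
proof (intro conjI allI ballI impI)
  have A: "online_algorithm (max_preempt \<pi>) A"
    using assms(1) by (simp add: competitive_with_advice_def)
  then show "online_algorithm (anti_sgkh k) (guesser A)"
    by (rule online_algorithm_guesser)
  fix N I assume "I \<in> inputs (anti_sgkh k)" and le: "input_length (anti_sgkh k) I \<le> N"
  then obtain n xs where I: "I = n # xs" "length xs = n" "set xs \<subseteq> {1..k}"
    by (auto simp: anti_sgkh_simps)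
  have nN: "n \<le> N"
    using le I(1,2) by (simp add: anti_sgkh_simps)
  define J where "J = requests n xs (n * k)"
  \<comment> \<open>The graph has \<open>n * k\<close> vertices with \<open>n \<le> N\<close>; this
    is the source of \<open>b (k * N)\<close>.\<close>
  have "input_length (max_preempt \<pi>) J \<le> k * N"
    using nN by (simp add: J_def max_preempt_simps mult.commute)
  then obtain \<phi>A where \<phi>A: "1 / c * real (opt (max_preempt \<pi>) J) \<le> real (profit (max_preempt \<pi>) J (run (max_preempt \<pi>) A \<phi>A J))"
    "reads_at_most (max_preempt \<pi>) A \<phi>A J (b (k * N))"
    using assms(1) requests_in_inputs unfolding competitive_with_advice_def J_def by blast
  \<comment> \<open>The aim is to miss the symbol, so a guess is wrong when it equals
    \<open>xs ! j\<close>.\<close>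
  define ok where "ok = {j. j < n \<and> guess A \<phi>A n xs j \<noteq> xs ! j}"
  define wrong where "wrong = {j. j < n \<and> guess A \<phi>A n xs j = xs ! j}"
  have card_ok: "card ok + card wrong = n"
  proof -
    have "ok \<union> wrong = {..<n}" "ok \<inter> wrong = {}"
      by (auto simp: ok_def wrong_def)
    then show ?thesis
      by (metis card_Un_disjoint card_lessThan finite_Un finite_lessThan)
  qed
  \<comment> \<open>As many wrong guesses as the list can name: all of them, or exactly
    \<open>k * s n\<close>.\<close>
  obtain D where D: "D \<subseteq> wrong" "card D = min (card wrong) (k * s n)"
    by (meson min.cobounded1 obtain_subset_with_card_n)
  have "Suc ` D \<subseteq> {1..n}"
    using D(1) by (auto simp: wrong_def)
  moreover have "card (Suc ` D) \<le> k * s n"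
    using D(2) by (simp add: card_image)
  ultimately obtain w where w: "marked (k * s n) (L n) w \<inter> {1..n} = Suc ` D"
    using ex_marked[OF _ _ L] by metis
  define \<phi> where "\<phi> = (\<lambda>j. if j < extra_bits n then w j else \<phi>A (j - extra_bits n))"
  have shift: "(\<lambda>t. \<phi> (extra_bits n + t)) = \<phi>A"
    by (simp add: \<phi>_def)
  have marked: "Suc j \<in> marked (k * s n) (L n) \<phi> \<longleftrightarrow> j \<in> D" if "j < n" for j
  proof -
    have "marked (k * s n) (L n) \<phi> = marked (k * s n) (L n) w"
      by (intro marked_cong) (simp add: \<phi>_def extra_bits_def)
    then have "Suc j \<in> marked (k * s n) (L n) \<phi> \<longleftrightarrow> Suc j \<in> marked (k * s n) (L n) w \<inter> {1..n}"
      using that by simp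
    also have "\<dots> \<longleftrightarrow> j \<in> D"
      unfolding w by auto
    finally show ?thesis .
  qed
  have flip: "y mod k + 1 \<noteq> y" if "y \<in> {1..k}" for y
    using that k2 by (cases "y = k") auto
  have "run (anti_sgkh k) (guesser A) \<phi> I ! j \<noteq> xs ! j \<longleftrightarrow> j \<in> ok \<or> j \<in> D" if "j < n" for j
  proof (cases "j \<in> D")
    case True
    then have "guess A \<phi>A n xs j = xs ! j"
      using D(1) by (auto simp: wrong_def)
    moreover from this have "xs ! j \<in> {1..k}"
      using guess_props(1)[OF A] by metis
    ultimately show ?thesis
      using True that flip by (simp add: I(1) run_guesser_nth[OF I(2) that] shift marked[OF that] Let_def)
  next
    case False
    then show ?thesis
      using that by (simp add: I(1) run_guesser_nth[OF I(2) that] shift marked[OF that] ok_def)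
  qed
  then have "{j. j < n \<and> run (anti_sgkh k) (guesser A) \<phi> I ! j \<noteq> xs ! j} = ok \<union> D"
    using D(1) by (auto simp: ok_def wrong_def)
  moreover have "card (ok \<union> D) = card ok + card D"
    using D(1) by (intro card_Un_disjoint) (auto simp: ok_def wrong_def intro: finite_subset)
  ultimately have profit: "profit (anti_sgkh k) I (run (anti_sgkh k) (guesser A) \<phi> I) = card ok + card D"
    using profit_anti_sgkh[OF I(2)] I(1) by simp
  have opt: "opt (anti_sgkh k) I \<le> n"
    using opt_anti_sgkh_le[OF I(2) k_pos] I(1) by simp
  have optA: "n \<le> opt (max_preempt \<pi>) J"
    using opt_requests_ge[OF I(2,3)] by (simp add: J_def)
  have profitA: "profit (max_preempt \<pi>) J (run (max_preempt \<pi>) A \<phi>A J) = card (kept_by A \<phi>A n xs (n * k))"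
    by (simp add: max_preempt_simps J_def kept_by_def)
  have "1 / c * real (opt (anti_sgkh k) I) \<le> real (card ok + card D)"
  \<comment> \<open>Both main cases need \<open>0 < n\<close>, one for a positive optimum and the
    other for \<open>card_kept_le\<close>.\<close>
  proof (cases "n = 0")
    case True
    then show ?thesis
      using opt by simp
  next
    case False
    show ?thesis
    proof (cases "card wrong \<le> k * s n")
      case True
      have "profit (max_preempt \<pi>) J (run (max_preempt \<pi>) A \<phi>A J) \<le> opt (max_preempt \<pi>) J"
      proof (rule profit_le_opt_max_preempt)
        show "length (run (max_preempt \<pi>) A \<phi>A J) = length J"
          by (simp add: run_def max_preempt_simps del: upt_Suc)
        show "feasible (max_preempt \<pi>) J (run (max_preempt \<pi>) A \<phi>A J)"
          using A requests_in_inputs by (simp add: online_algorithm_def J_def)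
      qed
      (* Here c < 1 has to be excluded: A cannot beat the optimum, which is positive. *)
      with \<phi>A(1) have "1 / c * real (opt (max_preempt \<pi>) J) \<le> 1 * real (opt (max_preempt \<pi>) J)"
        by simp
      moreover have "0 < real (opt (max_preempt \<pi>) J)"
        using optA False by simp
      ultimately have "1 / c \<le> 1"
        by (simp only: mult_le_cancel_right_pos)
      then have "1 / c * real (opt (anti_sgkh k) I) \<le> 1 * real n"
        using opt assms(2) by (intro mult_mono) auto
      also have "n = card ok + card D"
        using True D(2) card_ok by simp
      finally show ?thesis
        by simp
    next
      case False
      have "1 / c * real (opt (anti_sgkh k) I) \<le> 1 / c * real (opt (max_preempt \<pi>) J)"
        using opt optA assms(2) by (intro mult_left_mono) auto
      also have "\<dots> \<le> real (card (kept_by A \<phi>A n xs (n * k)))"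
        using \<phi>A(1) profitA by simp
      also have "\<dots> \<le> real (card ok + k * s n)"
        using card_kept_le[OF A, of n \<phi>A xs] \<open>n \<noteq> 0\<close> by (simp only: ok_def of_nat_le_iff neq0_conv)
      also have "k * s n = card D"
        using False D(2) by simp
      finally show ?thesis .
    qed
  qed
  moreover have "reads_at_most (anti_sgkh k) (guesser A) \<phi> I (b (k * N) + extra_bits N)"
    unfolding I(1)
  proof (rule reads_at_most_guesser[OF I(2)])
    show "reads_at_most (max_preempt \<pi>) A (\<lambda>t. \<phi> (extra_bits n + t)) (requests n xs (n * k)) (b (k * N))"
      using \<phi>A(2) by (simp add: shift J_def)
    show "b (k * N) + extra_bits n \<le> b (k * N) + extra_bits N"
      using monoD[OF mono_extra_bits nN] by simp
  qed
  ultimately show "\<exists>\<phi>. 1 / c * real (opt (anti_sgkh k) I) \<le> real (profit (anti_sgkh k) I (run (anti_sgkh k) (guesser A) \<phi> I)) \<and>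
      reads_at_most (anti_sgkh k) (guesser A) \<phi> I (b (k * N) + extra_bits N)"
    using profit by metis
qed

end

lemma bigo_log_squared:
  "(\<lambda>n. real (C * Suc (floorlog 2 n) * Suc (floorlog 2 n))) \<in> O(\<lambda>n. (log 2 (real n))\<^sup>2)"
proof (rule bigoI)
  show "\<forall>\<^sub>F n in sequentially. norm (real (C * Suc (floorlog 2 n) * Suc (floorlog 2 n)))
      \<le> (9 * real C) * norm ((log 2 (real n))\<^sup>2)"
    \<comment> \<open>For \<open>n \<ge> 2\<close> the logarithm is at least 1, so
      \<open>Suc (floorlog 2 n)\<close> is at most \<open>log 2 n + 2\<close>, hence at most three
      times the logarithm. Squaring gives the constant 9.\<close>
    using eventually_ge_at_top[of 2]
  proof eventually_elim
    case (elim n)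
    then have log: "1 \<le> log 2 (real n)"
      by (simp add: le_log_iff)
    have "real (floorlog 2 n) \<le> log 2 (real n) + 1"
      using elim log by (simp add: floorlog_def)
    with log have "real (Suc (floorlog 2 n)) \<le> 3 * log 2 (real n)"
      by simp
    then have "(real (Suc (floorlog 2 n)))\<^sup>2 \<le> (3 * log 2 (real n))\<^sup>2"
      by (intro power_mono) simp_all
    then have "real C * (real (Suc (floorlog 2 n)))\<^sup>2 \<le> real C * (3 * log 2 (real n))\<^sup>2"
      by (intro mult_left_mono) simp_all
    moreover have "real (C * Suc (floorlog 2 n) * Suc (floorlog 2 n)) = real C * (real (Suc (floorlog 2 n)))\<^sup>2"
      by (simp only: of_nat_mult power2_eq_square mult.assoc)
    moreover have "(9 * real C) * norm ((log 2 (real n))\<^sup>2) = real C * (3 * log 2 (real n))\<^sup>2"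
      by (simp add: power_mult_distrib)
    ultimately show ?case
      by (simp only: real_norm_def abs_of_nat)
  qed
qed

theorem theorem17:
  fixes \<pi> :: "nat pair_pre_digraph set"
    and H :: "nat pair_pre_digraph"
    and k :: nat
    and c :: real
    and b :: "nat \<Rightarrow> nat"
  assumes "graph_property \<pi>"
    and "nontrivial_property \<pi>"
    and "hereditary \<pi>"
    and "smallest_forbidden \<pi> H"
    and "k = card (pverts H)"
    and "c > 0"
    and "\<exists>A. competitive_with_advice (max_preempt \<pi>) A c b"
  shows "\<exists>B g. (\<lambda>n. real (g n)) \<in> O(\<lambda>n. (log 2 (real n))\<^sup>2) \<and>
           competitive_with_advice (anti_sgkh k) B c (\<lambda>n. b (k * n) + g n)"
proof -
  have k2: "2 \<le> k"
    using smallest_forbidden_card_ge_2[OF assms(1-4)] assms(5) by simp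
  have H: "pair_graph H" "H \<notin> \<pi>"
    using assms(4) by (simp_all add: smallest_forbidden_def)
  from ex_iso_on_lessThan[OF H(1)] obtain H' where H': "pair_graph H'" "pverts H' = {..<k}"
    "digraph_iso (with_proj H) (with_proj H')"
    unfolding assms(5) .
  have "H' \<notin> \<pi>"
    using graph_propertyD(2)[OF assms(1) _ H(1) digraph_iso_with_proj_sym[OF H(1) H'(3)]] H(2) by blast
  \<comment> \<open>The \<open>Suc\<close> keeps \<open>L n\<close> positive also for
    \<open>n = 0\<close>, as \<open>ex_pattern_rich_relation\<close> demands.\<close>
  define L where "L = (\<lambda>n. Suc (floorlog 2 n))"
  define e where "e = card {(i, j). i < j \<and> j < k}"
  define s where "s = (\<lambda>n. k * k * (k * k * L n * 2 ^ e))"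
  have L: "n < 2 ^ L n" for n
  proof (cases "n = 0")
    case False
    then have "n < 2 ^ floorlog 2 n"
      using floorlog_bounds[of n 2] by simp
    also have "\<dots> \<le> 2 ^ L n"
      unfolding L_def by (rule power_increasing) simp_all
    finally show ?thesis .
  qed simp
  have mono_L: "mono L"
    by (intro monoI) (simp add: L_def floorlog_mono)
  \<comment> \<open>\<open>G n\<close> and \<open>R n\<close> are fixed once for every
    \<open>n\<close>. The guesser learns \<open>n\<close> from the first request, so it needs no
    advice to know them.\<close>
  have "\<exists>G. G \<in> \<pi> \<and> pverts G = {..<n}" for n
    using ex_member_on_lessThan[OF assms(1-3)] by metis
  then obtain G where G: "\<And>n. G n \<in> \<pi>" "\<And>n. pverts (G n) = {..<n}"
    by metis
  have "\<exists>R. \<forall>T\<subseteq>{..<n}. s n \<le> card T \<longrightarrow> contains_pattern k (parcs H') R T" for n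
    by (rule ex_pattern_rich_relation[OF _ _ L e_def]) (use k2 in \<open>simp_all add: L_def s_def\<close>)
  then obtain R where R: "\<And>n. \<forall>T\<subseteq>{..<n}. s n \<le> card T \<longrightarrow> contains_pattern k (parcs H') (R n) T"
    by metis
  have mono_s: "mono s"
    using mono_L by (intro monoI) (simp add: s_def monoD)
  interpret anti_guessing_reduction \<pi> k H' G R s L
    using R by (intro anti_guessing_reduction.intro[OF assms(1,3) k2 H'(1,2) \<open>H' \<notin> \<pi>\<close> G _ L mono_s mono_L])
      (simp only: simp_thms)
  obtain A where "competitive_with_advice (max_preempt \<pi>) A c b"
    using assms(7) by blast
  then have "competitive_with_advice (anti_sgkh k) (guesser A) c (\<lambda>n. b (k * n) + extra_bits n)"
    using competitive_guesser assms(6) by blast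
  \<comment> \<open>There are \<open>k * s n\<close> numbers of \<open>L n\<close> bits, and
    \<open>s n\<close> is itself linear in \<open>L n\<close>. This gives the squared logarithm,
    with a factor that depends on \<open>k\<close> only.\<close>
  moreover have "extra_bits n = (k * k * k * k * k * 2 ^ e) * Suc (floorlog 2 n) * Suc (floorlog 2 n)" for n
    unfolding extra_bits_def by (simp only: s_def L_def mult_ac)
  then have "(\<lambda>n. real (extra_bits n)) \<in> O(\<lambda>n. (log 2 (real n))\<^sup>2)"
    using bigo_log_squared by (simp only:)
  ultimately show ?thesis
    by blast
qed

end
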